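(* Let $(X,d_X)$ be a finite metric space with $|X|=n\ge1$, let $X=\{x_1,x_2,\ldots,x_n\}$ be an enumeration of its points, and let $u_X$ be the maximal subdominant ultrametric on $X$. Then there is an isomorphism of persistence vector spaces over $\mathbb{Z}_2$ (the field with two elements) $$H_0(\mathrm{K}^{\mathrm{VR}}_\bullet(X),\mathbb{Z}_2)\;\cong\;\mathbb{I}(0,\infty)\oplus\bigoplus_{2\le i\le n}\mathbb{I}\Big(0,\ \min_{k<i}u_X(x_k,x_i)\Big).$$
   Context: **Vietoris-Rips complex.** For $\delta\ge 0$, $\mathrm{K}^{\mathrm{VR}}_\delta(X)$ is the abstract simplicial complex of all nonempty $\sigma\subseteq X$ with $\max_{x,x'\in\sigma}d_X(x,x')\le\delta$. For $\delta\le\delta'$ there is the inclusion $\mathrm{K}^{\mathrm{VR}}_\delta(X)\subseteq \mathrm{K}^{\mathrm{VR}}_{\delta'}(X)$. **Persistence vector spaces.** A persistence vector space over a field $\mathbb{F}$ is a family of $\mathbb{F}$-vector spaces $\{V_\delta\}_{\delta\in[0,\infty)}$ with linear maps $v_{\delta,\delta'}:V_\delta\to V_{\delta'}$ for $\delta\le\delta'$, such that $v_{\delta,\delta}=\mathrm{id}$ and $v_{\delta,\delta''}=v_{\delta',\delta''}\circ v_{\delta,\delta'}$ for $\delta\le\delta'\le\delta''$. An isomorphism $\mathbb{V}\cong\mathbb{W}$ is a family of linear isomorphisms $\alpha_\delta:V_\delta\to W_\delta$ with $\alpha_{\delta'}\circ v_{\delta,\delta'}=w_{\delta,\delta'}\circ\alpha_\delta$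 for all $\delta\le\delta'$. Direct sums are taken pointwise. $H_0(\mathrm{K}^{\mathrm{VR}}_\bullet(X),\mathbb{F})$ has spaces $H_0(\mathrm{K}^{\mathrm{VR}}_\delta(X),\mathbb{F})$ (simplicial homology) and maps induced by the inclusions. **Interval persistence vector spaces.** For $0\le b<d\le\infty$, $\mathbb{I}(b,d)$ is the persistence vector space equal to $\mathbb{F}$ at every $\delta$ with $b\le\delta<d$ and $0$ at all other $\delta$, with identity maps between copies of $\mathbb{F}$ and zero maps otherwise. **Maximal subdominant ultrametric.** $u_X(x,x)=0$ and, for $x\ne x'$, $$u_X(x,x')=\min\ \max_{1\le i\le m}d_X(x_{i-1},x_i),$$ where the minimum is over all finite sequences $x=x_0,x_1,\ldots,x_m=x'$ of pairwise distinct points of $X$. *)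

theory Defs
  imports
    "HOL-Analysis.Abstract_Metric_Spaces"
    "HOL-Library.Extended_Real"
    "HOL-Combinatorics.Permutations"
    "HOL-Number_Theory.Residues"
    "Jordan_Normal_Form.Missing_VectorSpace"
begin

text \<open>
  Vector spaces, linear maps and binary direct sums are those of the AFP entry VectorSpace
  (\<^locale>\<open>vectorspace\<close>, \<^locale>\<open>linear_map\<close>, \<^const>\<open>direct_sum\<close>), built on the carrier-based
  modules of HOL-Algebra. The record type of modules extends that of rings, so a module carries
  fields \<open>monoid.mult\<close> and \<open>one\<close> that have no meaning; they are filled with dummies below.
\<close>

definition direct_sum_family ::
    "'i set \<Rightarrow> ('i \<Rightarrow> ('f, 'v, 'm) module_scheme) \<Rightarrow> ('f, 'i \<Rightarrow> 'v) module" where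
  "direct_sum_family I M =
    \<lparr>carrier = {f \<in> \<Pi>\<^sub>E i\<in>I. carrier (M i). finite {i \<in> I. f i \<noteq> \<zero>\<^bsub>M i\<^esub>}},
     monoid.mult = (\<lambda>f g. \<lambda>i\<in>I. \<zero>\<^bsub>M i\<^esub>),
     one = (\<lambda>i\<in>I. \<zero>\<^bsub>M i\<^esub>),
     zero = (\<lambda>i\<in>I. \<zero>\<^bsub>M i\<^esub>),
     add = (\<lambda>f g. \<lambda>i\<in>I. f i \<oplus>\<^bsub>M i\<^esub> g i),
     smult = (\<lambda>a f. \<lambda>i\<in>I. a \<odot>\<^bsub>M i\<^esub> f i)\<rparr>"

definition quotient_module ::
    "('f, 'v, 'm) module_scheme \<Rightarrow> 'v set \<Rightarrow> ('f, 'v set) module" where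
  "quotient_module M N =
    \<lparr>carrier = a_rcosets\<^bsub>M\<^esub> N,
     monoid.mult = (\<lambda>A B. N),
     one = N,
     zero = N,
     add = (\<lambda>A B. A <+>\<^bsub>M\<^esub> B),
     smult = (\<lambda>a A. \<Union>v\<in>A. N +>\<^bsub>M\<^esub> (a \<odot>\<^bsub>M\<^esub> v))\<rparr>"


section \<open>Persistence vector spaces\<close>

record ('f, 'v) persistence_family =
  pspace :: "real \<Rightarrow> ('f, 'v) module"
  pmap :: "real \<Rightarrow> real \<Rightarrow> 'v \<Rightarrow> 'v"

text \<open>
  The index set is \<open>[0, \<infinity>)\<close>; values at negative indices, of \<^const>\<open>pmap\<close> at \<open>\<delta> > \<delta>'\<close>, and of its
  maps outside the carrier are irrelevant.
\<close>

locale persistence_vector_space =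
  fixes F :: "('f, 'm) ring_scheme" and V :: "('f, 'v) persistence_family"
  assumes vectorspace: "\<And>\<delta>. 0 \<le> \<delta> \<Longrightarrow> vectorspace F (pspace V \<delta>)"
    and linear: "\<And>\<delta> \<delta>'. 0 \<le> \<delta> \<Longrightarrow> \<delta> \<le> \<delta>' \<Longrightarrow>
      linear_map F (pspace V \<delta>) (pspace V \<delta>') (pmap V \<delta> \<delta>')"
    and identity: "\<And>\<delta> v. 0 \<le> \<delta> \<Longrightarrow> v \<in> carrier (pspace V \<delta>) \<Longrightarrow> pmap V \<delta> \<delta> v = v"
    and composition: "\<And>\<delta> \<delta>' \<delta>'' v. 0 \<le> \<delta> \<Longrightarrow> \<delta> \<le> \<delta>' \<Longrightarrow> \<delta>' \<le> \<delta>'' \<Longrightarrow>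
      v \<in> carrier (pspace V \<delta>) \<Longrightarrow> pmap V \<delta> \<delta>'' v = pmap V \<delta>' \<delta>'' (pmap V \<delta> \<delta>' v)"

definition persistence_isomorphism ::
    "('f, 'm) ring_scheme \<Rightarrow> ('f, 'v) persistence_family \<Rightarrow> ('f, 'w) persistence_family
      \<Rightarrow> (real \<Rightarrow> 'v \<Rightarrow> 'w) \<Rightarrow> bool" where
  "persistence_isomorphism F V W \<alpha> \<longleftrightarrow>
    (\<forall>\<delta>\<ge>0. linear_map F (pspace V \<delta>) (pspace W \<delta>) (\<alpha> \<delta>) \<and>
      bij_betw (\<alpha> \<delta>) (carrier (pspace V \<delta>)) (carrier (pspace W \<delta>))) \<and>
    (\<forall>\<delta>\<ge>0. \<forall>\<delta>'\<ge>\<delta>. \<forall>v\<in>carrier (pspace V \<delta>).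
      \<alpha> \<delta>' (pmap V \<delta> \<delta>' v) = pmap W \<delta> \<delta>' (\<alpha> \<delta> v))"

definition persistence_isomorphic ::
    "('f, 'm) ring_scheme \<Rightarrow> ('f, 'v) persistence_family \<Rightarrow> ('f, 'w) persistence_family \<Rightarrow> bool" where
  "persistence_isomorphic F V W \<longleftrightarrow>
    persistence_vector_space F V \<and> persistence_vector_space F W \<and>
    (\<exists>\<alpha>. persistence_isomorphism F V W \<alpha>)"

definition persistence_sum ::
    "('f, 'v) persistence_family \<Rightarrow> ('f, 'w) persistence_family
      \<Rightarrow> ('f, 'v \<times> 'w) persistence_family" where
  "persistence_sum V W =
    \<lparr>pspace = (\<lambda>\<delta>. direct_sum (pspace V \<delta>) (pspace W \<delta>)),
     pmap = (\<lambda>\<delta> \<delta>'. map_prod (pmap V \<delta> \<delta>') (pmap W \<delta> \<delta>'))\<rparr>"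

definition persistence_sum_family ::
    "'i set \<Rightarrow> ('i \<Rightarrow> ('f, 'v) persistence_family) \<Rightarrow> ('f, 'i \<Rightarrow> 'v) persistence_family" where
  "persistence_sum_family I V =
    \<lparr>pspace = (\<lambda>\<delta>. direct_sum_family I (\<lambda>i. pspace (V i) \<delta>)),
     pmap = (\<lambda>\<delta> \<delta>' f. \<lambda>i\<in>I. pmap (V i) \<delta> \<delta>' (f i))\<rparr>"

definition interval_persistence ::
    "('f, 'm) ring_scheme \<Rightarrow> real \<Rightarrow> ereal \<Rightarrow> ('f, 'f) persistence_family" where
  "interval_persistence F b d =
    (let alive = (\<lambda>\<delta>. b \<le> \<delta> \<and> ereal \<delta> < d) in
    \<lparr>pspace = (\<lambda>\<delta>.
       \<lparr>carrier = (if alive \<delta> then carrier F else {\<zero>\<^bsub>F\<^esub>}),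
        monoid.mult = monoid.mult F, one = one F, zero = zero F, add = add F,
        smult = monoid.mult F\<rparr>),
     pmap = (\<lambda>\<delta> \<delta>' v. if alive \<delta> \<and> alive \<delta>' then v else \<zero>\<^bsub>F\<^esub>)\<rparr>)"


section \<open>Simplicial homology\<close>

text \<open>
  An abstract simplicial complex is given by its set \<open>K\<close> of simplices. An oriented \<open>p\<close>-simplex is
  a list of \<open>p + 1\<close> distinct vertices spanning a simplex, up to even permutations. A
  \<open>p\<close>-chain is a finitely supported function on oriented simplices that changes sign when the
  orientation is reversed; it is extended by zero to all other lists, so that for \<open>K \<subseteq> K'\<close> the
  chain map induced by the inclusion is the identity function.
\<close>

definition simplicial_chains ::
    "('f, 'm) ring_scheme \<Rightarrow> 'a set set \<Rightarrow> nat \<Rightarrow> ('f, 'a list \<Rightarrow> 'f) module" where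
  "simplicial_chains F K p =
    \<lparr>carrier = {c. (\<forall>xs. c xs \<in> carrier F) \<and>
       (\<forall>xs. c xs \<noteq> \<zero>\<^bsub>F\<^esub> \<longrightarrow> length xs = Suc p \<and> distinct xs \<and> set xs \<in> K) \<and>
       finite {xs. c xs \<noteq> \<zero>\<^bsub>F\<^esub>} \<and>
       (\<forall>xs \<pi>. \<pi> permutes {..<length xs} \<longrightarrow>
         c (permute_list \<pi> xs) = (if evenperm \<pi> then c xs else \<ominus>\<^bsub>F\<^esub> c xs))},
     monoid.mult = (\<lambda>c c' xs. \<zero>\<^bsub>F\<^esub>),
     one = (\<lambda>xs. \<zero>\<^bsub>F\<^esub>),
     zero = (\<lambda>xs. \<zero>\<^bsub>F\<^esub>),
     add = (\<lambda>c c' xs. c xs \<oplus>\<^bsub>F\<^esub> c' xs),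
     smult = (\<lambda>a c xs. a \<otimes>\<^bsub>F\<^esub> c xs)\<rparr>"

text \<open>
  This is the linear extension of
  \<open>[v\<^sub>0, \<dots>, v\<^sub>p] \<mapsto> \<Sum>\<^sub>i (-1)\<^sup>i [v\<^sub>0, \<dots>, v\<^sub>i\<^sub>-\<^sub>1, v\<^sub>i\<^sub>+\<^sub>1, \<dots>, v\<^sub>p]\<close>, read off coefficientwise: the elementary
  chain \<open>[v\<^sub>0, \<dots>, v\<^sub>p]\<close> takes the value \<open>(-1)\<^sup>i\<close> on \<open>v\<^sub>i # [v\<^sub>0, \<dots>, v\<^sub>i\<^sub>-\<^sub>1, v\<^sub>i\<^sub>+\<^sub>1, \<dots>, v\<^sub>p]\<close>.
  The sum is restricted to the support because \<^const>\<open>finsum\<close> needs a finite index set.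
\<close>

definition simplicial_boundary ::
    "('f, 'm) ring_scheme \<Rightarrow> ('a list \<Rightarrow> 'f) \<Rightarrow> 'a list \<Rightarrow> 'f" where
  "simplicial_boundary F c xs = (\<Oplus>\<^bsub>F\<^esub>v\<in>{v. c (v # xs) \<noteq> \<zero>\<^bsub>F\<^esub>}. c (v # xs))"

text \<open>Homology is unreduced: the boundary map on \<open>0\<close>-chains is zero.\<close>

definition simplicial_cycles ::
    "('f, 'm) ring_scheme \<Rightarrow> 'a set set \<Rightarrow> nat \<Rightarrow> ('a list \<Rightarrow> 'f) set" where
  "simplicial_cycles F K p =
    {c \<in> carrier (simplicial_chains F K p). p > 0 \<longrightarrow> simplicial_boundary F c = (\<lambda>xs. \<zero>\<^bsub>F\<^esub>)}"

definition simplicial_boundaries ::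
    "('f, 'm) ring_scheme \<Rightarrow> 'a set set \<Rightarrow> nat \<Rightarrow> ('a list \<Rightarrow> 'f) set" where
  "simplicial_boundaries F K p =
    simplicial_boundary F ` carrier (simplicial_chains F K (Suc p))"

definition simplicial_homology ::
    "('f, 'm) ring_scheme \<Rightarrow> 'a set set \<Rightarrow> nat \<Rightarrow> ('f, ('a list \<Rightarrow> 'f) set) module" where
  "simplicial_homology F K p =
    quotient_module ((simplicial_chains F K p)\<lparr>carrier := simplicial_cycles F K p\<rparr>)
      (simplicial_boundaries F K p)"

text \<open>
  The map on homology induced by an inclusion into \<open>K'\<close>: the class of a cycle \<open>c\<close> is sent to
  the class of \<open>c\<close> in the homology of \<open>K'\<close>.
\<close>

definition inclusion_homology_map ::
    "('f, 'm) ring_scheme \<Rightarrow> 'a set set \<Rightarrow> nat \<Rightarrow> ('a list \<Rightarrow> 'f) set \<Rightarrow> ('a list \<Rightarrow> 'f) set" where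
  "inclusion_homology_map F K' p C =
    (\<Union>c\<in>C. simplicial_boundaries F K' p +>\<^bsub>simplicial_chains F K' p\<^esub> c)"


section \<open>Vietoris--Rips complexes and the maximal subdominant ultrametric\<close>

definition VR_complex :: "'a set \<Rightarrow> ('a \<Rightarrow> 'a \<Rightarrow> real) \<Rightarrow> real \<Rightarrow> 'a set set" where
  "VR_complex X d \<delta> =
    {\<sigma>. \<sigma> \<subseteq> X \<and> \<sigma> \<noteq> {} \<and> finite \<sigma> \<and> (\<forall>x\<in>\<sigma>. \<forall>x'\<in>\<sigma>. d x x' \<le> \<delta>)}"

definition VR_persistent_homology ::
    "('f, 'm) ring_scheme \<Rightarrow> nat \<Rightarrow> 'a set \<Rightarrow> ('a \<Rightarrow> 'a \<Rightarrow> real)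
      \<Rightarrow> ('f, ('a list \<Rightarrow> 'f) set) persistence_family" where
  "VR_persistent_homology F p X d =
    \<lparr>pspace = (\<lambda>\<delta>. simplicial_homology F (VR_complex X d \<delta>) p),
     pmap = (\<lambda>\<delta> \<delta>'. inclusion_homology_map F (VR_complex X d \<delta>') p)\<rparr>"

text \<open>Chains \<open>x = x\<^sub>0, \<dots>, x\<^sub>m = x'\<close> are lists \<open>xs\<close> with \<open>xs ! i = x\<^sub>i\<close>, so \<open>m = length xs - 1\<close>.\<close>

definition subdominant_ultrametric :: "'a set \<Rightarrow> ('a \<Rightarrow> 'a \<Rightarrow> real) \<Rightarrow> 'a \<Rightarrow> 'a \<Rightarrow> real" where
  "subdominant_ultrametric X d x x' =
    (if x = x' then 0
     else Min {Max ((\<lambda>i. d (xs ! (i - 1)) (xs ! i)) ` {1..length xs - 1}) | xs.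
       xs \<noteq> [] \<and> set xs \<subseteq> X \<and> distinct xs \<and> hd xs = x \<and> last xs = x'})"

end

theory Submission
  imports Defs
begin

text \<open>
  Two points lie in the same component of the Vietoris--Rips complex at scale \<open>\<delta>\<close> iff
  \<open>u\<^sub>X \<le> \<delta>\<close>. Attach every \<open>x\<^sub>i\<close> with \<open>i \<ge> 2\<close> to a nearest earlier point, its parent; this is the
  elder rule. The chains \<open>x\<^sub>1\<close> and \<open>x\<^sub>i - parent(x\<^sub>i)\<close> form a basis of the \<open>0\<close>-chains, and the basis
  chain of index \<open>i\<close> bounds once \<open>\<delta>\<close> reaches \<open>min\<^sub>k\<^sub><\<^sub>i u\<^sub>X(x\<^sub>k, x\<^sub>i)\<close>. Its coordinate functional is the
  total weight of a chain on the descendants of \<open>x\<^sub>i\<close>. As long as \<open>i\<close> is alive, the descendants are a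
  union of components, so the functional vanishes on boundaries. Hence the living coordinates have
  exactly the boundaries as kernel, and they induce the isomorphism on homology, over any field.
\<close>

section \<open>Quotients and direct sums of vector spaces\<close>

text \<open>The obstacle is naturality. At a single scale, choosing one point in each component
  gives a basis of homology, but choices made scale by scale need not be compatible with the
  inclusions. Here every choice is made once, in the tree of parents, so the functionals on chains
  are the same at all scales; raising \<delta> only discards the coordinates that have died, which
  is exactly what the structure maps of the intervals do. Nearest refers to \<open>u_X\<close>, not
  to \<open>d_X\<close>: a dead point need not be adjacent to its parent, only joined to it by a
  path, and their difference is then a telescoping sum of edge boundaries. No dimensions are
  counted. That nothing but boundaries lies in the kernel is shown by clearing a chain from its last
  vertex down: at a living index the coefficient is forced to be zero, at a dead one the chain
  subtracted is a boundary.\<close>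

lemma linear_mapI:
  assumes "vectorspace K V" "vectorspace K W"
    and "\<And>v. v \<in> carrier V \<Longrightarrow> T v \<in> carrier W"
    and "\<And>v w. v \<in> carrier V \<Longrightarrow> w \<in> carrier V \<Longrightarrow> T (v \<oplus>\<^bsub>V\<^esub> w) = T v \<oplus>\<^bsub>W\<^esub> T w"
    and "\<And>a v. a \<in> carrier K \<Longrightarrow> v \<in> carrier V \<Longrightarrow> T (a \<odot>\<^bsub>V\<^esub> v) = a \<odot>\<^bsub>W\<^esub> T v"
  shows "linear_map K V W T"
  using assms
  by (auto simp: linear_map_def mod_hom_def mod_hom_axioms_def module_hom_def vectorspace_def)

lemma linear_mapD:
  assumes "linear_map K V W T"
  shows "vectorspace K V" "vectorspace K W"
    and "\<And>v. v \<in> carrier V \<Longrightarrow> T v \<in> carrier W"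
    and "\<And>v w. v \<in> carrier V \<Longrightarrow> w \<in> carrier V \<Longrightarrow> T (v \<oplus>\<^bsub>V\<^esub> w) = T v \<oplus>\<^bsub>W\<^esub> T w"
    and "\<And>a v. a \<in> carrier K \<Longrightarrow> v \<in> carrier V \<Longrightarrow> T (a \<odot>\<^bsub>V\<^esub> v) = a \<odot>\<^bsub>W\<^esub> T v"
  using assms
  by (auto simp: linear_map_def mod_hom_def mod_hom_axioms_def module_hom_def)

locale subspace_quotient =
  fixes K :: "('f, 'm) ring_scheme" and V :: "('f, 'v, 'n) module_scheme" and N :: "'v set"
  assumes vs: "vectorspace K V" and sub: "LinearCombinations.submodule K N V"
begin

sublocale vectorspace K V by (rule vs)

sublocale abelian_subgroup N V
proof (rule abelian_subgroupI3)
  show "additive_subgroup N V"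
  proof (rule additive_subgroupI, rule add.subgroupI)
    show "N \<subseteq> carrier V" "N \<noteq> {}"
      using sub by (auto simp: submodule_def)
    show "\<ominus>\<^bsub>V\<^esub> v \<in> N" if "v \<in> N" for v
    proof -
      \<comment> \<open>A submodule is closed under sums and scalars by definition, so negation is
        expressed as a scalar.\<close>
      have "\<ominus>\<^bsub>V\<^esub> v = (\<ominus>\<^bsub>K\<^esub> \<one>\<^bsub>K\<^esub>) \<odot>\<^bsub>V\<^esub> v"
        using that sub by (subst smult_minus_1) (auto simp: submodule_def)
      with that sub show ?thesis by (simp add: submodule_def)
    qed
    show "v \<oplus>\<^bsub>V\<^esub> w \<in> N" if "v \<in> N" "w \<in> N" for v w
      using that sub by (simp add: submodule_def)
  qed
qed (rule abelian_group_axioms)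

lemma smult_N: "a \<in> carrier K \<Longrightarrow> v \<in> N \<Longrightarrow> a \<odot>\<^bsub>V\<^esub> v \<in> N"
  using sub by (simp add: submodule_def)

lemma in_rcosetE:
  assumes "w \<in> N +>\<^bsub>V\<^esub> v"
  obtains h where "h \<in> N" "w = h \<oplus>\<^bsub>V\<^esub> v"
  using assms by (auto simp: a_r_coset_def')

text \<open>The scalar action on \<open>quotient_module\<close> is a union over all representatives.
  Two representatives differ by an element of \<open>N\<close>, and so do their multiples, hence all
  members of the union are the same coset.\<close>

lemma smult_rcoset:
  assumes "a \<in> carrier K" "v \<in> carrier V"
  shows "(\<Union>w\<in>N +>\<^bsub>V\<^esub> v. N +>\<^bsub>V\<^esub> (a \<odot>\<^bsub>V\<^esub> w)) = N +>\<^bsub>V\<^esub> (a \<odot>\<^bsub>V\<^esub> v)"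
proof -
  have "N +>\<^bsub>V\<^esub> (a \<odot>\<^bsub>V\<^esub> w) = N +>\<^bsub>V\<^esub> (a \<odot>\<^bsub>V\<^esub> v)" if "w \<in> N +>\<^bsub>V\<^esub> v" for w
  proof -
    obtain h where h: "h \<in> N" "w = h \<oplus>\<^bsub>V\<^esub> v" using \<open>w \<in> _\<close> by (rule in_rcosetE)
    then have "a \<odot>\<^bsub>V\<^esub> w = a \<odot>\<^bsub>V\<^esub> h \<oplus>\<^bsub>V\<^esub> a \<odot>\<^bsub>V\<^esub> v"
      using assms subsetD[OF a_subset h(1)] by (simp add: smult_r_distr)
    then have "a \<odot>\<^bsub>V\<^esub> w \<in> N +>\<^bsub>V\<^esub> (a \<odot>\<^bsub>V\<^esub> v)"
      using a_rcosI[OF smult_N[OF assms(1) h(1)] a_subset] assms by simp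
    then show ?thesis
      using a_repr_independence[OF _ _ a_subgroup] assms by auto
  qed
  then show ?thesis by (intro UN_constant_eq[OF a_rcos_self[OF assms(2)]]) blast
qed

text \<open>This is the shape of \<open>inclusion_homology_map\<close>, with \<open>N\<close> and
  \<open>N'\<close> the boundaries of the smaller and the larger complex. Representatives that
  differ by \<open>N\<close> also differ by \<open>N'\<close>, so the union is a single
  coset.\<close>

lemma rcoset_subspace:
  assumes "LinearCombinations.submodule K N' V" "N \<subseteq> N'" "v \<in> carrier V"
  shows "(\<Union>w\<in>N +>\<^bsub>V\<^esub> v. N' +>\<^bsub>V\<^esub> w) = N' +>\<^bsub>V\<^esub> v"
proof -
  interpret N': subspace_quotient K V N'
    using vs assms(1) by (rule subspace_quotient.intro)
  have "N +>\<^bsub>V\<^esub> v \<subseteq> N' +>\<^bsub>V\<^esub> v"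
    using assms(2) by (auto simp: a_r_coset_def')
  then have "N' +>\<^bsub>V\<^esub> w = N' +>\<^bsub>V\<^esub> v" if "w \<in> N +>\<^bsub>V\<^esub> v" for w
    using a_repr_independence[OF _ assms(3) N'.a_subgroup] that by auto
  then show ?thesis by (intro UN_constant_eq[OF a_rcos_self[OF assms(3)]]) blast
qed

lemma carrier_quotient: "carrier (quotient_module V N) = (\<lambda>v. N +>\<^bsub>V\<^esub> v) ` carrier V"
  by (auto simp: quotient_module_def A_RCOSETS_def')

lemma quotient_ops:
  shows "\<zero>\<^bsub>quotient_module V N\<^esub> = N"
    and "v \<in> carrier V \<Longrightarrow> w \<in> carrier V \<Longrightarrow>
      (N +>\<^bsub>V\<^esub> v) \<oplus>\<^bsub>quotient_module V N\<^esub> (N +>\<^bsub>V\<^esub> w) = N +>\<^bsub>V\<^esub> (v \<oplus>\<^bsub>V\<^esub> w)"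
    and "a \<in> carrier K \<Longrightarrow> v \<in> carrier V \<Longrightarrow>
      a \<odot>\<^bsub>quotient_module V N\<^esub> (N +>\<^bsub>V\<^esub> v) = N +>\<^bsub>V\<^esub> (a \<odot>\<^bsub>V\<^esub> v)"
  using smult_rcoset by (auto simp: quotient_module_def a_rcos_sum)

lemma vectorspace_quotient: "vectorspace K (quotient_module V N)"
proof -
  \<comment> \<open>With the zero written as a coset, every group law reduces to the same law for
    representatives.\<close>
  have zero: "\<zero>\<^bsub>quotient_module V N\<^esub> = N +>\<^bsub>V\<^esub> \<zero>\<^bsub>V\<^esub>"
    using a_subset by (simp add: quotient_ops)
  have "abelian_group (quotient_module V N)"
  proof (rule abelian_groupI, goal_cases)
    case (6 A)
    then obtain v where v: "v \<in> carrier V" "A = N +>\<^bsub>V\<^esub> v" by (auto simp: carrier_quotient)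
    then show ?case
      by (intro bexI[of _ "N +>\<^bsub>V\<^esub> (\<ominus>\<^bsub>V\<^esub> v)"])
        (auto simp: carrier_quotient zero quotient_ops(2) M.l_neg)
  qed (auto simp: carrier_quotient zero quotient_ops(2) M.add.m_ac)
  then have "Module.module K (quotient_module V N)"
    by (intro moduleI is_cring)
      (auto simp: carrier_quotient quotient_ops smult_l_distr smult_r_distr smult_assoc1)
  then show ?thesis by (simp add: vectorspace_def field_axioms)
qed

text \<open>The first isomorphism theorem. Since \<open>T\<close> is constant on each coset of its
  kernel, the image of a coset is a singleton, and \<open>the_elem\<close> extracts its value
  without a choice of representative.\<close>

lemma kernel_quotient_map:
  assumes T: "linear_map K V W T" and N: "N = {v \<in> carrier V. T v = \<zero>\<^bsub>W\<^esub>}"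
    and surj: "T ` carrier V = carrier W"
  shows "\<And>v. v \<in> carrier V \<Longrightarrow> the_elem (T ` (N +>\<^bsub>V\<^esub> v)) = T v"
    and "linear_map K (quotient_module V N) W (\<lambda>C. the_elem (T ` C))"
    and "bij_betw (\<lambda>C. the_elem (T ` C)) (carrier (quotient_module V N)) (carrier W)"
proof -
  note lin = linear_mapD[OF T]
  have hom: "mod_hom K V W T" using T by (simp add: linear_map_def)
  have W: "abelian_group W" using lin(2) by (simp add: vectorspace_def Module.module_def)
  note W0 = abelian_monoid.l_zero[OF abelian_group.axioms(1)[OF W]]
  have eq: "T w = T v" if v: "v \<in> carrier V" and w: "w \<in> N +>\<^bsub>V\<^esub> v" for v w
  proof -
    obtain h where h: "h \<in> N" "w = h \<oplus>\<^bsub>V\<^esub> v" using w by (rule in_rcosetE)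
    have "h \<in> carrier V" "T h = \<zero>\<^bsub>W\<^esub>" using h(1) unfolding N by blast+
    then show ?thesis using v h(2) by (simp add: lin(4) W0 lin(3))
  qed
  show val: "the_elem (T ` (N +>\<^bsub>V\<^esub> v)) = T v" if v: "v \<in> carrier V" for v
  proof -
    have "T ` (N +>\<^bsub>V\<^esub> v) = (\<lambda>_. T v) ` (N +>\<^bsub>V\<^esub> v)"
      by (rule image_cong[OF refl]) (rule eq[OF v])
    also have "\<dots> = {T v}"
      by (rule image_constant) (rule a_rcos_self[OF v])
    finally show ?thesis by simp
  qed
  show "linear_map K (quotient_module V N) W (\<lambda>C. the_elem (T ` C))"
    by (rule linear_mapI[OF vectorspace_quotient lin(2)])
      (auto simp: carrier_quotient quotient_ops(2,3) val lin(3-5))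
  have inj: "N +>\<^bsub>V\<^esub> v = N +>\<^bsub>V\<^esub> w" if vw: "v \<in> carrier V" "w \<in> carrier V" and "T v = T w" for v w
  proof -
    have "T (v \<ominus>\<^bsub>V\<^esub> w) = \<zero>\<^bsub>W\<^esub>"
      using that mod_hom.f_minus[OF hom vw] abelian_group.r_neg[OF W lin(3)[OF vw(2)]]
      by (simp add: a_minus_def)
    then have "v \<ominus>\<^bsub>V\<^esub> w \<in> N" unfolding N using vw by blast
    then have "N +>\<^bsub>V\<^esub> (v \<oplus>\<^bsub>V\<^esub> \<ominus>\<^bsub>V\<^esub> w) = N"
      unfolding a_minus_def using vw by (intro a_coset_join2[OF _ a_subgroup]) auto
    then show ?thesis using vw a_subset by (rule a_coset_add_inv1)
  qed
  have "inj_on (\<lambda>C. the_elem (T ` C)) (carrier (quotient_module V N))"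
    unfolding carrier_quotient
  proof (rule inj_onI, elim imageE, goal_cases)
    case (1 A B v w)
    then show ?case using inj[of v w] val[of v] val[of w] by simp
  qed
  moreover have "(\<lambda>C. the_elem (T ` C)) ` carrier (quotient_module V N) = T ` carrier V"
    unfolding carrier_quotient image_image by (rule image_cong[OF refl]) (rule val)
  ultimately show "bij_betw (\<lambda>C. the_elem (T ` C)) (carrier (quotient_module V N)) (carrier W)"
    unfolding bij_betw_def surj by (rule conjI)
qed

end

section \<open>Direct sums over a finite index set\<close>

lemma direct_sum_family_simps:
  assumes "finite I"
  shows "carrier (direct_sum_family I M) = (\<Pi>\<^sub>E i\<in>I. carrier (M i))"
    and "\<zero>\<^bsub>direct_sum_family I M\<^esub> = (\<lambda>i\<in>I. \<zero>\<^bsub>M i\<^esub>)"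
    and "f \<oplus>\<^bsub>direct_sum_family I M\<^esub> g = (\<lambda>i\<in>I. f i \<oplus>\<^bsub>M i\<^esub> g i)"
    and "a \<odot>\<^bsub>direct_sum_family I M\<^esub> f = (\<lambda>i\<in>I. a \<odot>\<^bsub>M i\<^esub> f i)"
  using assms by (auto simp: direct_sum_family_def)

lemma vectorspace_direct_sum_family:
  assumes "field K" "finite I" "\<And>i. i \<in> I \<Longrightarrow> vectorspace K (M i)"
  shows "vectorspace K (direct_sum_family I M)"
proof -
  have mod: "Module.module K (M i)" if "i \<in> I" for i
    using assms(3)[OF that] by (simp add: vectorspace_def)
  have grp: "abelian_group (M i)" if "i \<in> I" for i
    using mod[OF that] by (simp add: Module.module_def)
  have mon: "abelian_monoid (M i)" if "i \<in> I" for i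
    using grp[OF that] by (simp add: abelian_group_def)
  note ops = direct_sum_family_simps[OF assms(2)]
  have mem: "f i \<in> carrier (M i)" if "f \<in> (\<Pi>\<^sub>E i\<in>I. carrier (M i))" "i \<in> I" for f i
    using that by (rule PiE_mem)
  have "abelian_group (direct_sum_family I M)"
  proof (rule abelian_groupI, goal_cases)
    case (1 f g)
    then show ?case by (auto simp: ops mem abelian_monoid.a_closed[OF mon])
  next
    case 2
    show ?case by (auto simp: ops abelian_monoid.zero_closed[OF mon])
  next
    case (3 f g h)
    then show ?case
      unfolding ops by (intro restrict_ext) (simp add: mem abelian_monoid.a_assoc[OF mon])
  next
    case (4 f g)
    then show ?case
      unfolding ops by (intro restrict_ext) (simp add: mem abelian_monoid.a_comm[OF mon])
  next
    case (5 f)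
    \<comment> \<open>Componentwise operations return functions that are \<open>undefined\<close>
      off \<open>I\<close>; the result is \<open>f\<close> itself because \<open>f\<close> is
      extensional.\<close>
    then have "(\<lambda>i\<in>I. \<zero>\<^bsub>M i\<^esub> \<oplus>\<^bsub>M i\<^esub> f i) = restrict f I"
      unfolding ops by (intro restrict_ext) (simp add: mem abelian_monoid.l_zero[OF mon])
    with 5 show ?case by (simp add: ops PiE_restrict cong: restrict_cong)
  next
    case (6 f)
    then have f: "f i \<in> carrier (M i)" if "i \<in> I" for i
      using that by (simp add: ops mem)
    have "(\<lambda>i\<in>I. \<ominus>\<^bsub>M i\<^esub> f i) \<in> carrier (direct_sum_family I M)"
      by (simp add: ops f abelian_group.a_inv_closed[OF grp])
    moreover have "(\<lambda>i\<in>I. \<ominus>\<^bsub>M i\<^esub> f i) \<oplus>\<^bsub>direct_sum_family I M\<^esub> f = \<zero>\<^bsub>direct_sum_family I M\<^esub>"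
      unfolding ops by (intro restrict_ext) (simp add: f abelian_group.l_neg[OF grp])
    ultimately show ?case by blast
  qed
  moreover have "cring K" using assms(1) by (simp add: field_def domain_def)
  ultimately have "Module.module K (direct_sum_family I M)"
  proof (intro moduleI, goal_cases)
    case (3 a f)
    then show ?case by (auto simp: ops mem Module.module.smult_closed[OF mod])
  next
    case (4 a b f)
    then show ?case unfolding ops
      by (intro restrict_ext) (simp add: mem Module.module.smult_l_distr[OF mod])
  next
    case (5 a f g)
    then show ?case unfolding ops
      by (intro restrict_ext) (simp add: mem Module.module.smult_r_distr[OF mod])
  next
    case (6 a b f)
    then show ?case unfolding ops
      by (intro restrict_ext) (simp add: mem Module.module.smult_assoc1[OF mod])
  next
    case (7 f)
    then have "(\<lambda>i\<in>I. \<one>\<^bsub>K\<^esub> \<odot>\<^bsub>M i\<^esub> f i) = restrict f I"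
      unfolding ops by (intro restrict_ext) (simp add: mem Module.module.smult_one[OF mod])
    with 7 show ?case by (simp add: ops PiE_restrict)
  qed
  with assms(1) show ?thesis by (simp add: vectorspace_def)
qed

section \<open>Persistence vector spaces\<close>

lemma persistence_vector_space_interval:
  fixes F (structure)
  assumes "field F"
  shows "persistence_vector_space F (interval_persistence F b d)"
proof -
  interpret field F by fact
  let ?V = "interval_persistence F b d"
  have vs: "vectorspace F (pspace ?V \<delta>)" for \<delta>
  proof -
    define V where "V = pspace ?V \<delta>"
    \<comment> \<open>The full space and the zero space are treated together: both are closed under
      the operations of \<open>F\<close>, which is all that the axioms require.\<close>
    have V: "carrier V = carrier F \<or> carrier V = {\<zero>}" "zero V = \<zero>" "add V = add F" "smult V = monoid.mult F"
      by (auto simp: V_def interval_persistence_def Let_def)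
    have sub: "carrier V \<subseteq> carrier F" "\<zero> \<in> carrier V" using V(1) by auto
    have closed: "v \<in> carrier V \<Longrightarrow> w \<in> carrier V \<Longrightarrow> v \<oplus> w \<in> carrier V"
      "v \<in> carrier V \<Longrightarrow> \<ominus> v \<in> carrier V"
      "a \<in> carrier F \<Longrightarrow> v \<in> carrier V \<Longrightarrow> a \<otimes> v \<in> carrier V" for a v w
      using V(1) by (elim disjE; simp)+
    have "abelian_group V"
    proof (rule abelian_groupI, unfold V)
      show "\<exists>w\<in>carrier V. w \<oplus> v = \<zero>" if "v \<in> carrier V" for v
        using closed(2)[OF that] l_neg[OF subsetD[OF sub(1) that]] by blast
    qed (simp_all add: sub(2) closed subsetD[OF sub(1)] a_ac)
    then have "Module.module F V"
      by (rule moduleI[OF is_cring], unfold V)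
        (simp_all add: closed subsetD[OF sub(1)] l_distr r_distr m_assoc)
    then show ?thesis by (simp add: V_def vectorspace_def field_axioms)
  qed
  show ?thesis
  proof (rule persistence_vector_space.intro, goal_cases)
    case (1 \<delta>) show ?case by (rule vs)
  next
    case (2 \<delta> \<delta>')
    show ?case
      by (rule linear_mapI[OF vs vs]) (auto simp: interval_persistence_def Let_def)
  next
    case (4 \<delta> \<delta>' \<delta>'' v)
    \<comment> \<open>Convexity of the interval: a bar alive at both ends is alive in between.
      Otherwise the composite through \<delta>' would vanish while the direct map is the
      identity.\<close>
    have "ereal \<delta>' < d" if "ereal \<delta>'' < d"
      using 4(3) that by (metis ereal_less_eq(3) le_less_trans)
    with 4 show ?case by (auto simp: interval_persistence_def Let_def split: if_splits)
  qed (auto simp: interval_persistence_def Let_def split: if_splits)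
qed

lemma persistence_vector_space_sum:
  assumes "persistence_vector_space F V" "persistence_vector_space F W"
  shows "persistence_vector_space F (persistence_sum V W)"
proof -
  interpret V: persistence_vector_space F V by fact
  interpret W: persistence_vector_space F W by fact
  have vs: "vectorspace F (direct_sum (pspace V \<delta>) (pspace W \<delta>))" if "0 \<le> \<delta>" for \<delta>
    using that by (simp add: direct_sum_is_vs V.vectorspace W.vectorspace)
  show ?thesis
  proof (rule persistence_vector_space.intro, goal_cases)
    case (1 \<delta>) then show ?case by (simp add: persistence_sum_def vs)
  next
    case (2 \<delta> \<delta>')
    note L = linear_mapD[OF V.linear[OF 2]] linear_mapD[OF W.linear[OF 2]]
    from 2 have "linear_map F (direct_sum (pspace V \<delta>) (pspace W \<delta>))
        (direct_sum (pspace V \<delta>') (pspace W \<delta>')) (map_prod (pmap V \<delta> \<delta>') (pmap W \<delta> \<delta>'))"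
      by (intro linear_mapI vs) (auto simp: direct_sum_def L)
    then show ?case by (simp add: persistence_sum_def)
  next
    case 4 
    with V.composition[OF 4(1-3)] W.composition[OF 4(1-3)] show ?case 
      by (auto simp: persistence_sum_def direct_sum_def)
  qed (auto simp: persistence_sum_def direct_sum_def V.identity W.identity)
qed

lemma persistence_vector_space_sum_family:
  assumes "field F" "finite I" "\<And>i. i \<in> I \<Longrightarrow> persistence_vector_space F (V i)"
  shows "persistence_vector_space F (persistence_sum_family I V)"
proof -
  note ax = assms(3)[THEN persistence_vector_space.vectorspace]
    assms(3)[THEN persistence_vector_space.linear]
    assms(3)[THEN persistence_vector_space.identity]
    assms(3)[THEN persistence_vector_space.composition]
  note ops = direct_sum_family_simps[OF assms(2)]
  have vs: "vectorspace F (direct_sum_family I (\<lambda>i. pspace (V i) \<delta>))" if "0 \<le> \<delta>" for \<delta>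
    using that by (intro vectorspace_direct_sum_family assms(1,2) ax(1))
  have mem: "f i \<in> carrier (pspace (V i) \<delta>)"
    if "f \<in> (\<Pi>\<^sub>E i\<in>I. carrier (pspace (V i) \<delta>))" "i \<in> I" for f i \<delta>
    using that by (rule PiE_mem)
  show ?thesis
  proof (rule persistence_vector_space.intro, goal_cases)
    case (1 \<delta>) then show ?case by (simp add: persistence_sum_family_def vs)
  next
    case (2 \<delta> \<delta>')
    note L = linear_mapD[OF ax(2)[OF _ 2]]
    from 2 have "linear_map F (direct_sum_family I (\<lambda>i. pspace (V i) \<delta>))
        (direct_sum_family I (\<lambda>i. pspace (V i) \<delta>')) (\<lambda>f. \<lambda>i\<in>I. pmap (V i) \<delta> \<delta>' (f i))"
      by (intro linear_mapI vs) (auto simp: ops L mem intro!: restrict_ext)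
    then show ?case by (simp add: persistence_sum_family_def)
  next
    case (3 \<delta> v)
    then have v: "v \<in> (\<Pi>\<^sub>E i\<in>I. carrier (pspace (V i) \<delta>))"
      by (simp add: persistence_sum_family_def ops)
    then have "(\<lambda>i\<in>I. pmap (V i) \<delta> \<delta> (v i)) = restrict v I"
      using 3(1) by (intro restrict_ext ax(3) mem)
    with v show ?case by (simp add: persistence_sum_family_def PiE_restrict)
  next
    case (4 \<delta> \<delta>' \<delta>'' v)
    then have v: "v \<in> (\<Pi>\<^sub>E i\<in>I. carrier (pspace (V i) \<delta>))"
      by (simp add: persistence_sum_family_def ops)
    show ?case unfolding persistence_sum_family_def
      using ax(4)[OF _ 4(1-3) mem[OF v]] by (auto intro!: restrict_ext)
  qed
qed

section \<open>Homology in degree zero\<close>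

definition simplicial_complex :: "'a set set \<Rightarrow> bool" where
  "simplicial_complex K \<longleftrightarrow> (\<forall>\<sigma>\<in>K. \<forall>\<tau>\<subseteq>\<sigma>. \<tau> \<noteq> {} \<longrightarrow> \<tau> \<in> K)"

lemma simplicial_complex_VR: "simplicial_complex (VR_complex X d \<delta>)"
  unfolding simplicial_complex_def VR_complex_def by (blast intro: finite_subset)

lemma VR_complex_mono: "\<delta> \<le> \<delta>' \<Longrightarrow> VR_complex X d \<delta> \<subseteq> VR_complex X d \<delta>'"
  by (force simp: VR_complex_def)

lemma simplicial_chains_simps:
  shows "\<zero>\<^bsub>simplicial_chains F K p\<^esub> = (\<lambda>xs. \<zero>\<^bsub>F\<^esub>)"
    and "c \<oplus>\<^bsub>simplicial_chains F K p\<^esub> c' = (\<lambda>xs. c xs \<oplus>\<^bsub>F\<^esub> c' xs)"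
    and "a \<odot>\<^bsub>simplicial_chains F K p\<^esub> c = (\<lambda>xs. a \<otimes>\<^bsub>F\<^esub> c xs)"
  by (simp_all add: simplicial_chains_def)

lemma simplicial_chainsD:
  assumes "c \<in> carrier (simplicial_chains F K p)"
  shows "c xs \<in> carrier F"
    and "c xs \<noteq> \<zero>\<^bsub>F\<^esub> \<Longrightarrow> length xs = Suc p \<and> distinct xs \<and> set xs \<in> K"
    and "finite {xs. c xs \<noteq> \<zero>\<^bsub>F\<^esub>}"
    and "\<pi> permutes {..<length xs} \<Longrightarrow>
      c (permute_list \<pi> xs) = (if evenperm \<pi> then c xs else \<ominus>\<^bsub>F\<^esub> c xs)"
  using assms by (simp_all add: simplicial_chains_def)

lemma simplicial_chainsI:
  assumes "\<And>xs. c xs \<in> carrier F"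
    and "\<And>xs. c xs \<noteq> \<zero>\<^bsub>F\<^esub> \<Longrightarrow> length xs = Suc p \<and> distinct xs \<and> set xs \<in> K"
    and "finite {xs. c xs \<noteq> \<zero>\<^bsub>F\<^esub>}"
    and "\<And>\<pi> xs. \<pi> permutes {..<length xs} \<Longrightarrow>
      c (permute_list \<pi> xs) = (if evenperm \<pi> then c xs else \<ominus>\<^bsub>F\<^esub> c xs)"
  shows "c \<in> carrier (simplicial_chains F K p)"
  using assms by (simp add: simplicial_chains_def)

lemma simplicial_chains_mono:
  "K \<subseteq> K' \<Longrightarrow> carrier (simplicial_chains F K p) \<subseteq> carrier (simplicial_chains F K' p)"
  by (auto simp: simplicial_chains_def)

text \<open>Only the carrier of a chain space depends on the complex, so a coset may be read in
  either of two complexes.\<close>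

lemma rcoset_simplicial_chains:
  "N +>\<^bsub>simplicial_chains F K p\<^esub> c = N +>\<^bsub>simplicial_chains F K' p\<^esub> c"
  by (simp add: a_r_coset_def' simplicial_chains_simps)

text \<open>A list with at most one entry has only one orientation; this trivialises the sign
  condition on 0-chains.\<close>

lemma permutes_length_le_1:
  assumes "\<pi> permutes {..<length xs}" "length xs \<le> Suc 0"
  shows "\<pi> = id"
proof -
  have "{..<length xs} \<subseteq> {0}" using assms(2) by auto
  with assms(1) have "\<pi> permutes {0}" by (rule permutes_subset)
  then show ?thesis by simp
qed

section \<open>Chain spaces, boundaries and induced maps over a field\<close>

context field
begin

lemma vectorspace_simplicial_chains: "vectorspace R (simplicial_chains R K p)"
proof -
  let ?C = "simplicial_chains R K p"
  have add: "(\<lambda>xs. c xs \<oplus> c' xs) \<in> carrier ?C"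
    if "c \<in> carrier ?C" "c' \<in> carrier ?C" for c c'
  proof (rule simplicial_chainsI)
    note D = simplicial_chainsD[OF that(1)] simplicial_chainsD[OF that(2)]
    show "c xs \<oplus> c' xs \<in> carrier R" for xs using D(1,5) by simp
    show "length xs = Suc p \<and> distinct xs \<and> set xs \<in> K" if "c xs \<oplus> c' xs \<noteq> \<zero>" for xs
      using that D(2,6)[of xs] by (cases "c xs = \<zero>"; cases "c' xs = \<zero>") auto
    show "finite {xs. c xs \<oplus> c' xs \<noteq> \<zero>}"
      by (rule finite_subset[OF _ finite_UnI[OF D(3,7)]]) auto
    show "c (permute_list \<pi> xs) \<oplus> c' (permute_list \<pi> xs)
        = (if evenperm \<pi> then c xs \<oplus> c' xs else \<ominus> (c xs \<oplus> c' xs))"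
      if "\<pi> permutes {..<length xs}" for \<pi> xs
      using D(1,5) by (simp add: D(4,8)[OF that] minus_add)
  qed
  have smult: "(\<lambda>xs. a \<otimes> c xs) \<in> carrier ?C" if a: "a \<in> carrier R" and c: "c \<in> carrier ?C" for a c
  proof (rule simplicial_chainsI)
    note D = simplicial_chainsD[OF c]
    show "a \<otimes> c xs \<in> carrier R" for xs using D(1) a by simp
    show "length xs = Suc p \<and> distinct xs \<and> set xs \<in> K" if "a \<otimes> c xs \<noteq> \<zero>" for xs
      using that a D(2)[of xs] by (cases "c xs = \<zero>") auto
    show "finite {xs. a \<otimes> c xs \<noteq> \<zero>}"
      by (rule finite_subset[OF _ D(3)]) (use a in auto)
    show "a \<otimes> c (permute_list \<pi> xs) = (if evenperm \<pi> then a \<otimes> c xs else \<ominus> (a \<otimes> c xs))"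
      if "\<pi> permutes {..<length xs}" for \<pi> xs
      using D(1) a by (simp add: D(4)[OF that] r_minus)
  qed
  have zero: "(\<lambda>xs. \<zero>) \<in> carrier ?C" by (rule simplicial_chainsI) auto
  have neg: "\<exists>c'\<in>carrier ?C. c' \<oplus>\<^bsub>?C\<^esub> c = \<zero>\<^bsub>?C\<^esub>" if "c \<in> carrier ?C" for c
    using smult[OF _ that, of "\<ominus> \<one>"] simplicial_chainsD(1)[OF that]
    by (intro bexI[of _ "\<lambda>xs. \<ominus> \<one> \<otimes> c xs"]) (auto simp: simplicial_chains_simps l_minus l_neg)
  have "abelian_group ?C"
    by (rule abelian_groupI)
      (auto simp: simplicial_chains_simps simplicial_chainsD(1)
        intro!: ext intro: a_assoc a_comm add zero neg[unfolded simplicial_chains_simps])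
  then have "Module.module R ?C"
    by (intro moduleI is_cring)
      (auto simp: simplicial_chains_simps simplicial_chainsD(1)
        intro!: ext intro: l_distr r_distr m_assoc smult)
  then show ?thesis by (simp add: vectorspace_def field_axioms)
qed

lemma simplicial_chains_closed:
  assumes "c \<in> carrier (simplicial_chains R K p)"
  shows "c' \<in> carrier (simplicial_chains R K p) \<Longrightarrow>
      (\<lambda>xs. c xs \<oplus> c' xs) \<in> carrier (simplicial_chains R K p)"
    and "a \<in> carrier R \<Longrightarrow> (\<lambda>xs. a \<otimes> c xs) \<in> carrier (simplicial_chains R K p)"
proof -
  interpret C: vectorspace R "simplicial_chains R K p" by (rule vectorspace_simplicial_chains)
  show "c' \<in> carrier (simplicial_chains R K p) \<Longrightarrow>
      (\<lambda>xs. c xs \<oplus> c' xs) \<in> carrier (simplicial_chains R K p)"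
    using C.M.a_closed[OF assms] by (simp add: simplicial_chains_simps)
  show "a \<in> carrier R \<Longrightarrow> (\<lambda>xs. a \<otimes> c xs) \<in> carrier (simplicial_chains R K p)"
    using C.smult_closed[OF _ assms] by (simp add: simplicial_chains_simps)
qed

text \<open>The boundary sums over a set that varies with the chain. A common finite index set
  allows boundaries of different chains to be compared term by term.\<close>

lemma simplicial_boundary_eq:
  assumes "c \<in> carrier (simplicial_chains R K p)" "finite A" "{v. c (v # xs) \<noteq> \<zero>} \<subseteq> A"
  shows "simplicial_boundary R c xs = (\<Oplus>v\<in>A. c (v # xs))"
  unfolding simplicial_boundary_def
  by (rule add.finprod_mono_neutral_cong_left)
    (use assms simplicial_chainsD(1)[OF assms(1)] in auto)

lemma finite_coboundary:
  assumes "c \<in> carrier (simplicial_chains R K p)"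
  shows "finite {v. c (v # xs) \<noteq> \<zero>}"
proof -
  have "finite ((\<lambda>v. v # xs) -` {ys. c ys \<noteq> \<zero>})"
    by (rule finite_vimageI[OF simplicial_chainsD(3)[OF assms]]) (simp add: inj_on_def)
  then show ?thesis by (simp add: vimage_def)
qed

text \<open>The target complex may be larger than the source. This makes the boundaries of
  \<open>K\<close> a subspace of the chains of \<open>K'\<close>, as needed to compare cosets along
  an inclusion.\<close>

lemma linear_map_simplicial_boundary:
  assumes K': "simplicial_complex K'" and "K \<subseteq> K'"
  shows "linear_map R (simplicial_chains R K (Suc 0)) (simplicial_chains R K' 0)
    (simplicial_boundary R)"
proof (rule linear_mapI[OF vectorspace_simplicial_chains vectorspace_simplicial_chains])
  fix c assume c: "c \<in> carrier (simplicial_chains R K (Suc 0))"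
  note D = simplicial_chainsD[OF c]
  have closed: "simplicial_boundary R c xs \<in> carrier R" for xs
    unfolding simplicial_boundary_def using D(1) by (intro finsum_closed) auto
  have supp: "\<exists>v. c (v # xs) \<noteq> \<zero>" if "simplicial_boundary R c xs \<noteq> \<zero>" for xs
    by (rule ccontr) (use that in \<open>simp add: simplicial_boundary_def\<close>)
  have len: "length xs = Suc 0 \<and> distinct xs \<and> set xs \<in> K'"
    if nz: "simplicial_boundary R c xs \<noteq> \<zero>" for xs
  proof -
    obtain v where v: "c (v # xs) \<noteq> \<zero>" using supp[OF nz] by blast
    with D(2)[OF v] have "set (v # xs) \<in> K'" "set xs \<subseteq> set (v # xs)" "xs \<noteq> []"
      using assms(2) by auto
    with K' have "set xs \<in> K'"
      unfolding simplicial_complex_def by (metis set_empty)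
    with D(2)[OF v] show ?thesis by simp
  qed
  show "simplicial_boundary R c \<in> carrier (simplicial_chains R K' 0)"
  proof (rule simplicial_chainsI)
    \<comment> \<open>The support of the boundary consists of tails of lists in the support of
      \<open>c\<close>.\<close>
    show "finite {xs. simplicial_boundary R c xs \<noteq> \<zero>}"
      by (rule finite_subset[OF _ finite_imageI[OF D(3), of tl]]) (use supp in force)
    show "simplicial_boundary R c (permute_list \<pi> xs)
        = (if evenperm \<pi> then simplicial_boundary R c xs else \<ominus> simplicial_boundary R c xs)"
      if "\<pi> permutes {..<length xs}" for \<pi> xs
    proof (cases "length xs \<le> Suc 0")
      case True
      with that have "\<pi> = id" by (rule permutes_length_le_1)
      then show ?thesis by (simp add: evenperm_id)
    next
      case False
      then have "simplicial_boundary R c xs = \<zero>" "simplicial_boundary R c (permute_list \<pi> xs) = \<zero>"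
        using len[of xs] len[of "permute_list \<pi> xs"] by auto
      then show ?thesis by simp
    qed
  qed (use closed len in auto)
next
  fix c c' assume c: "c \<in> carrier (simplicial_chains R K (Suc 0))"
    and c': "c' \<in> carrier (simplicial_chains R K (Suc 0))"
  note cc = simplicial_chains_closed(1)[OF c c']
  have "simplicial_boundary R (\<lambda>xs. c xs \<oplus> c' xs) xs
      = simplicial_boundary R c xs \<oplus> simplicial_boundary R c' xs" for xs
  proof -
    define A where "A = {v. c (v # xs) \<noteq> \<zero>} \<union> {v. c' (v # xs) \<noteq> \<zero>}"
    have A: "finite A" unfolding A_def by (intro finite_UnI finite_coboundary[OF c] finite_coboundary[OF c'])
    have "simplicial_boundary R (\<lambda>xs. c xs \<oplus> c' xs) xs = (\<Oplus>v\<in>A. c (v # xs) \<oplus> c' (v # xs))"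
      by (rule simplicial_boundary_eq[OF cc A]) (auto simp: A_def)
    also have "\<dots> = (\<Oplus>v\<in>A. c (v # xs)) \<oplus> (\<Oplus>v\<in>A. c' (v # xs))"
      by (rule finsum_addf) (use simplicial_chainsD(1)[OF c] simplicial_chainsD(1)[OF c'] in auto)
    also have "\<dots> = simplicial_boundary R c xs \<oplus> simplicial_boundary R c' xs"
      using simplicial_boundary_eq[OF c A] simplicial_boundary_eq[OF c' A] by (simp add: A_def)
    finally show ?thesis .
  qed
  then show "simplicial_boundary R (c \<oplus>\<^bsub>simplicial_chains R K (Suc 0)\<^esub> c')
      = simplicial_boundary R c \<oplus>\<^bsub>simplicial_chains R K' 0\<^esub> simplicial_boundary R c'"
    unfolding simplicial_chains_simps by (rule ext)
next
  fix a c assume a: "a \<in> carrier R" and c: "c \<in> carrier (simplicial_chains R K (Suc 0))"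
  note ac = simplicial_chains_closed(2)[OF c a]
  have "simplicial_boundary R (\<lambda>xs. a \<otimes> c xs) xs = a \<otimes> simplicial_boundary R c xs" for xs
  proof -
    define A where "A = {v. c (v # xs) \<noteq> \<zero>}"
    have A: "finite A" unfolding A_def by (rule finite_coboundary[OF c])
    have "simplicial_boundary R (\<lambda>xs. a \<otimes> c xs) xs = (\<Oplus>v\<in>A. a \<otimes> c (v # xs))"
      by (rule simplicial_boundary_eq[OF ac A]) (auto simp: A_def a)
    also have "\<dots> = a \<otimes> (\<Oplus>v\<in>A. c (v # xs))"
      by (rule finsum_rdistr[symmetric, OF A a]) (use simplicial_chainsD(1)[OF c] in auto)
    also have "\<dots> = a \<otimes> simplicial_boundary R c xs"
      using simplicial_boundary_eq[OF c A] by (simp add: A_def)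
    finally show ?thesis .
  qed
  then show "simplicial_boundary R (a \<odot>\<^bsub>simplicial_chains R K (Suc 0)\<^esub> c)
      = a \<odot>\<^bsub>simplicial_chains R K' 0\<^esub> simplicial_boundary R c"
    unfolding simplicial_chains_simps by (rule ext)
qed

lemma submodule_simplicial_boundaries:
  assumes "simplicial_complex K'" "K \<subseteq> K'"
  shows "LinearCombinations.submodule R (simplicial_boundaries R K 0) (simplicial_chains R K' 0)"
  using mod_hom.im_is_submodule[of R "simplicial_chains R K (Suc 0)" "simplicial_chains R K' 0"]
    linear_map_simplicial_boundary[OF assms]
  by (simp add: linear_map_def mod_hom.im_def simplicial_boundaries_def)

lemma subspace_quotient_chains:
  assumes "simplicial_complex K"
  shows "subspace_quotient R (simplicial_chains R K 0) (simplicial_boundaries R K 0)"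
  by (rule subspace_quotient.intro[OF vectorspace_simplicial_chains
        submodule_simplicial_boundaries[OF assms subset_refl]])

text \<open>The cycle condition is guarded by \<open>p > 0\<close>, so every 0-chain is a
  cycle.\<close>

lemma simplicial_homology_0:
  "simplicial_homology R K 0 = quotient_module (simplicial_chains R K 0) (simplicial_boundaries R K 0)"
  by (simp add: simplicial_homology_def simplicial_cycles_def)

lemma inclusion_homology_map_rcoset:
  assumes K: "simplicial_complex K" and K': "simplicial_complex K'" and sub: "K \<subseteq> K'"
    and c: "c \<in> carrier (simplicial_chains R K 0)"
  shows "inclusion_homology_map R K' 0 (simplicial_boundaries R K 0 +>\<^bsub>simplicial_chains R K 0\<^esub> c)
    = simplicial_boundaries R K' 0 +>\<^bsub>simplicial_chains R K' 0\<^esub> c"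
proof -
  \<comment> \<open>The smaller coset is moved into the chains of \<open>K'\<close>, so that both
    boundary spaces are subspaces of one space.\<close>
  have "subspace_quotient R (simplicial_chains R K' 0) (simplicial_boundaries R K 0)"
    by (rule subspace_quotient.intro[OF vectorspace_simplicial_chains
          submodule_simplicial_boundaries[OF K' sub]])
  then have "(\<Union>w\<in>simplicial_boundaries R K 0 +>\<^bsub>simplicial_chains R K' 0\<^esub> c.
      simplicial_boundaries R K' 0 +>\<^bsub>simplicial_chains R K' 0\<^esub> w)
    = simplicial_boundaries R K' 0 +>\<^bsub>simplicial_chains R K' 0\<^esub> c"
  proof (rule subspace_quotient.rcoset_subspace)
    show "LinearCombinations.submodule R (simplicial_boundaries R K' 0) (simplicial_chains R K' 0)"
      by (rule submodule_simplicial_boundaries[OF K' subset_refl])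
    show "simplicial_boundaries R K 0 \<subseteq> simplicial_boundaries R K' 0"
      unfolding simplicial_boundaries_def by (intro image_mono simplicial_chains_mono sub)
    show "c \<in> carrier (simplicial_chains R K' 0)"
      using simplicial_chains_mono[OF sub] c by blast
  qed
  then show ?thesis
    by (simp add: inclusion_homology_map_def rcoset_simplicial_chains[where K = K and K' = K'])
qed

text \<open>Induced maps keep the representing chain and only enlarge its coset; linearity, identity
  and composition then follow on representatives.\<close>

lemma persistence_vector_space_filtration:
  assumes K: "\<And>\<delta>. simplicial_complex (K \<delta>)" and mono: "\<And>\<delta> \<delta>'. \<delta> \<le> \<delta>' \<Longrightarrow> K \<delta> \<subseteq> K \<delta>'"
  shows "persistence_vector_space R
    \<lparr>pspace = (\<lambda>\<delta>. simplicial_homology R (K \<delta>) 0), pmap = (\<lambda>\<delta> \<delta>'. inclusion_homology_map R (K \<delta>') 0)\<rparr>"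
proof (rule persistence_vector_space.intro, unfold persistence_family.simps simplicial_homology_0)
  note Q = subspace_quotient_chains[OF K]
  note incl = inclusion_homology_map_rcoset[OF K K mono]
  note ops = subspace_quotient.carrier_quotient[OF Q] subspace_quotient.quotient_ops(2,3)[OF Q]
  show vs: "vectorspace R (quotient_module (simplicial_chains R (K \<delta>) 0) (simplicial_boundaries R (K \<delta>) 0))" for \<delta>
    by (rule subspace_quotient.vectorspace_quotient[OF Q])
  have chains: "c \<in> carrier (simplicial_chains R (K \<delta>') 0)"
    if "\<delta> \<le> \<delta>'" "c \<in> carrier (simplicial_chains R (K \<delta>) 0)" for c \<delta> \<delta>'
    using simplicial_chains_mono[OF mono[OF that(1)]] that(2) by blast
  show "linear_map R (quotient_module (simplicial_chains R (K \<delta>) 0) (simplicial_boundaries R (K \<delta>) 0))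
      (quotient_module (simplicial_chains R (K \<delta>') 0) (simplicial_boundaries R (K \<delta>') 0))
      (inclusion_homology_map R (K \<delta>') 0)" if le: "\<delta> \<le> \<delta>'" for \<delta> \<delta>'
  proof -
    note closed = simplicial_chains_closed[of _ "K \<delta>" 0]
    show ?thesis
    proof (rule linear_mapI[OF vs vs], unfold ops(1), goal_cases)
      case (1 v)
      then show ?case using incl[OF le] chains[OF le] by auto
    next
      case (2 v w)
      then show ?case
        using chains[OF le] by (auto simp: ops incl[OF le] closed simplicial_chains_simps)
    next
      case (3 a v)
      then show ?case
        using chains[OF le] by (auto simp: ops incl[OF le] closed simplicial_chains_simps)
    qed
  qed
  show "inclusion_homology_map R (K \<delta>) 0 v = v"
    if "v \<in> carrier (quotient_module (simplicial_chains R (K \<delta>) 0) (simplicial_boundaries R (K \<delta>) 0))" for v \<delta>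
    using that incl[OF order_refl] by (auto simp: ops(1))
  show "inclusion_homology_map R (K \<delta>'') 0 v = inclusion_homology_map R (K \<delta>'') 0 (inclusion_homology_map R (K \<delta>') 0 v)"
    if "\<delta> \<le> \<delta>'" "\<delta>' \<le> \<delta>''"
      "v \<in> carrier (quotient_module (simplicial_chains R (K \<delta>) 0) (simplicial_boundaries R (K \<delta>) 0))" for v \<delta> \<delta>' \<delta>''
    using that incl[OF that(1)] incl[OF that(2) chains[OF that(1)]] incl[OF order_trans[OF that(1,2)]]
    by (auto simp: ops(1))
qed

end

section \<open>The subdominant ultrametric and the merge tree\<close>

text \<open>The edges of the Vietoris-Rips complex together with loops. On \<open>X\<close>, the
  reflexive transitive closure is the relation of lying in the same component.\<close>

definition links :: "'a set \<Rightarrow> ('a \<Rightarrow> 'a \<Rightarrow> real) \<Rightarrow> real \<Rightarrow> ('a \<times> 'a) set" where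
  "links X d \<delta> = {(y, z). y \<in> X \<and> z \<in> X \<and> d y z \<le> \<delta>}"

text \<open>Loop erasure. The ultrametric admits only paths through distinct points, so a walk that
  comes back to an earlier point is cut off at its visit there.\<close>

lemma rtrancl_distinct_path:
  assumes "(a, b) \<in> {(y, z). y \<in> X \<and> z \<in> X \<and> P y z}\<^sup>*" "a \<in> X"
  shows "\<exists>xs. xs \<noteq> [] \<and> set xs \<subseteq> X \<and> distinct xs \<and> hd xs = a \<and> last xs = b \<and> successively P xs"
  using assms
proof (induction rule: rtrancl_induct)
  case base
  then show ?case by (intro exI[of _ "[a]"]) simp
next
  case (step y z)
  then obtain xs where xs: "xs \<noteq> []" "set xs \<subseteq> X" "distinct xs" "hd xs = a" "last xs = y" "successively P xs"
    by blast
  show ?case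
  proof (cases "z \<in> set xs")
    case True
    then obtain ys zs where "xs = ys @ z # zs" by (meson split_list)
    with xs show ?thesis
      by (intro exI[of _ "ys @ [z]"]) (auto simp: successively_append_iff hd_append)
  next
    case False
    with xs step.hyps(2) show ?thesis
      by (intro exI[of _ "xs @ [z]"]) (auto simp: successively_append_iff)
  qed
qed

lemma successively_rtrancl:
  assumes "successively P xs" "xs \<noteq> []" "set xs \<subseteq> X"
  shows "(hd xs, last xs) \<in> {(y, z). y \<in> X \<and> z \<in> X \<and> P y z}\<^sup>*"
  using assms
proof (induction xs)
  case (Cons a xs)
  then show ?case
    by (cases xs) (auto intro: converse_rtrancl_into_rtrancl)
qed simp

text \<open>A minimum of maxima is at most \<delta> exactly if some path has all its steps at most
  \<delta>. Finiteness of \<open>X\<close> leaves finitely many distinct paths;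
  \<open>0 \<le> \<delta>\<close> settles the diagonal, where the ultrametric is set to 0.\<close>

lemma subdominant_ultrametric_le_iff:
  assumes X: "finite X" and ab: "a \<in> X" "b \<in> X" and "d a a = 0" "0 \<le> \<delta>"
  shows "subdominant_ultrametric X d a b \<le> \<delta> \<longleftrightarrow> (a, b) \<in> (links X d \<delta>)\<^sup>*"
proof (cases "a = b")
  case True
  with assms show ?thesis by (simp add: subdominant_ultrametric_def)
next
  case False
  define Paths where "Paths = {xs. xs \<noteq> [] \<and> set xs \<subseteq> X \<and> distinct xs \<and> hd xs = a \<and> last xs = b}"
  define len where "len = (\<lambda>xs. Max ((\<lambda>i. d (xs ! (i - 1)) (xs ! i)) ` {1..length xs - 1}))"
  have fin: "finite Paths"
    by (rule finite_subset[OF _ finite_subset_distinct[OF X]]) (auto simp: Paths_def)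
  \<comment> \<open>The direct jump shows that the minimum is not taken over the empty set.\<close>
  have ne: "[a, b] \<in> Paths" using ab False by (simp add: Paths_def)
  have u: "subdominant_ultrametric X d a b = Min (len ` Paths)"
    using False unfolding subdominant_ultrametric_def len_def Paths_def setcompr_eq_image by (simp only: if_False)
  have len: "len xs \<le> \<delta> \<longleftrightarrow> successively (\<lambda>y z. d y z \<le> \<delta>) xs" if "xs \<in> Paths" for xs
  proof -
    \<comment> \<open>With two vertices there is at least one step, so \<open>Max\<close> has a
      nonempty argument.\<close>
    have two: "2 \<le> length xs"
    proof (rule ccontr)
      assume "\<not> 2 \<le> length xs"
      then have "length xs = 0 \<or> length xs = 1" by linarith
      with that False show False by (auto simp: Paths_def length_Suc_conv)
    qed
    then have "len xs \<le> \<delta> \<longleftrightarrow> (\<forall>i\<in>{1..length xs - 1}. d (xs ! (i - 1)) (xs ! i) \<le> \<delta>)"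
      unfolding len_def by (subst Max_le_iff) simp_all
    also have "{1..length xs - 1} = Suc ` {..<length xs - 1}"
      by (simp add: image_Suc_lessThan)
    finally show ?thesis
      by (simp add: successively_conv_nth less_diff_conv lessThan_def)
  qed
  have "subdominant_ultrametric X d a b \<le> \<delta> \<longleftrightarrow> (\<exists>xs\<in>Paths. len xs \<le> \<delta>)"
    unfolding u using fin ne by (subst Min_le_iff) auto
  also have "\<dots> \<longleftrightarrow> (\<exists>xs\<in>Paths. successively (\<lambda>y z. d y z \<le> \<delta>) xs)"
    using len by blast
  also have "\<dots> \<longleftrightarrow> (a, b) \<in> (links X d \<delta>)\<^sup>*"
  proof
    assume "\<exists>xs\<in>Paths. successively (\<lambda>y z. d y z \<le> \<delta>) xs"
    then obtain xs where "xs \<in> Paths" "successively (\<lambda>y z. d y z \<le> \<delta>) xs" ..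
    with successively_rtrancl[of "\<lambda>y z. d y z \<le> \<delta>" xs X] show "(a, b) \<in> (links X d \<delta>)\<^sup>*"
      by (simp add: links_def Paths_def)
  next
    assume "(a, b) \<in> (links X d \<delta>)\<^sup>*"
    from rtrancl_distinct_path[OF this[unfolded links_def] ab(1)]
    show "\<exists>xs\<in>Paths. successively (\<lambda>y z. d y z \<le> \<delta>) xs"
      by (simp add: Bex_def Paths_def conj_assoc)
  qed
  finally show ?thesis .
qed

section \<open>The tree of parents and its subtrees\<close>

locale enumerated_metric_space = Metric_space X d
  for X :: "'a set" and d :: "'a \<Rightarrow> 'a \<Rightarrow> real" +
  fixes n :: nat and x :: "nat \<Rightarrow> 'a"
  assumes finite_X: "finite X" and n: "1 \<le> n" and bij: "bij_betw x {1..n} X"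
begin

lemma x_in [simp]: "1 \<le> i \<Longrightarrow> i \<le> n \<Longrightarrow> x i \<in> X"
  using bij_betwE[OF bij] by simp

lemma x_eq_iff [simp]: "i \<in> {1..n} \<Longrightarrow> j \<in> {1..n} \<Longrightarrow> x i = x j \<longleftrightarrow> i = j"
  by (rule inj_on_eq_iff[OF bij_betw_imp_inj_on[OF bij]])

definition merge :: "nat \<Rightarrow> real" where
  "merge i = Min ((\<lambda>k. subdominant_ultrametric X d (x k) (x i)) ` {1..<i})"

text \<open>Ties are broken arbitrarily, but without reference to \<delta>, so that one tree serves
  all scales.\<close>

definition parent :: "nat \<Rightarrow> nat" where
  "parent i = (SOME k. k \<in> {1..<i} \<and> subdominant_ultrametric X d (x k) (x i) = merge i)"

definition descends :: "(nat \<times> nat) set" where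
  "descends = {(i, parent i) | i. i \<in> {2..n}}\<^sup>*"

definition descendants :: "nat \<Rightarrow> 'a set" where
  "descendants i = x ` {j \<in> {1..n}. (j, i) \<in> descends}"

text \<open>The bar of index \<open>1\<close> never dies; its \<open>merge\<close> is a minimum over the empty set.\<close>

definition alive :: "real \<Rightarrow> nat \<Rightarrow> bool" where
  "alive \<delta> i \<longleftrightarrow> i = 1 \<or> \<delta> < merge i"

lemma parent:
  assumes "2 \<le> i"
  shows "1 \<le> parent i" "parent i < i"
    and "subdominant_ultrametric X d (x (parent i)) (x i) = merge i"
proof -
  have "merge i \<in> (\<lambda>k. subdominant_ultrametric X d (x k) (x i)) ` {1..<i}"
    unfolding merge_def using assms by (intro Min_in) auto
  then have "\<exists>k. k \<in> {1..<i} \<and> subdominant_ultrametric X d (x k) (x i) = merge i" by auto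
  from someI_ex[OF this] show "1 \<le> parent i" "parent i < i"
    "subdominant_ultrametric X d (x (parent i)) (x i) = merge i"
    by (auto simp: parent_def)
qed

lemma merge_le: "k \<in> {1..<i} \<Longrightarrow> merge i \<le> subdominant_ultrametric X d (x k) (x i)"
  unfolding merge_def by (intro Min_le) auto

lemma sym_links: "sym ((links X d \<delta>)\<^sup>*)"
  by (intro sym_rtrancl symI) (auto simp: links_def commute)

text \<open>The minimum defining \<open>merge i\<close> is attained at the parent, so once
  \<open>i\<close> is dead the parent lies in its component.\<close>

lemma links_parent:
  assumes "i \<in> {2..n}" "0 \<le> \<delta>" "\<not> alive \<delta> i"
  shows "(x (parent i), x i) \<in> (links X d \<delta>)\<^sup>*"
proof -
  have i: "2 \<le> i" using assms(1) by simp
  have "subdominant_ultrametric X d (x (parent i)) (x i) \<le> \<delta>"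
    using assms(3) by (simp add: alive_def parent(3)[OF i])
  then show ?thesis
    using assms(1,2) parent[OF i] finite_X by (subst (asm) subdominant_ultrametric_le_iff) auto
qed

lemma descends_iff:
  assumes "j \<in> {1..n}"
  shows "(j, i) \<in> descends \<longleftrightarrow> i = j \<or> 2 \<le> j \<and> (parent j, i) \<in> descends"
proof
  assume "(j, i) \<in> descends"
  then show "i = j \<or> 2 \<le> j \<and> (parent j, i) \<in> descends"
    unfolding descends_def by (cases rule: converse_rtranclE) auto
next
  assume "i = j \<or> 2 \<le> j \<and> (parent j, i) \<in> descends"
  then show "(j, i) \<in> descends"
    unfolding descends_def using assms by (auto intro: converse_rtrancl_into_rtrancl)
qed

text \<open>Parents come earlier in the enumeration. All triangularity used later comes from
  this.\<close>

lemma descends_le: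
  assumes "(j, i) \<in> descends"
  shows "i \<le> j"
  using assms unfolding descends_def
  by (induction rule: rtrancl_induct) (use parent(2) in fastforce)+

lemma in_descendants_iff:
  "j \<in> {1..n} \<Longrightarrow> x j \<in> descendants i \<longleftrightarrow> (j, i) \<in> descends"
  unfolding descendants_def by auto

lemma descendants_subset: "descendants i \<subseteq> X"
  by (auto simp: descendants_def)

lemma finite_descendants: "finite (descendants i)"
  by (rule finite_subset[OF descendants_subset finite_X])

text \<open>
  Of two linked points the later one is dead, so the step to its parent stays in the component and
  passes no living index.
\<close>

lemma descends_links:
  assumes "0 \<le> \<delta>" "alive \<delta> i" "j \<in> {1..n}" "l \<in> {1..n}" "(x j, x l) \<in> (links X d \<delta>)\<^sup>*"
  shows "(j, i) \<in> descends \<longleftrightarrow> (l, i) \<in> descends"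
proof -
  have "(j, i) \<in> descends \<longleftrightarrow> (l, i) \<in> descends"
    if "j \<in> {1..n}" "l < j" "1 \<le> l" "(x j, x l) \<in> (links X d \<delta>)\<^sup>*" for j l
    using that
  \<comment> \<open>Replacing the later index by its parent may reverse the order of the two
    indices, but it always lowers their sum.\<close>
  proof (induction "j + l" arbitrary: j l rule: less_induct)
    case less
    have lj: "(x l, x j) \<in> (links X d \<delta>)\<^sup>*" using less.prems(4) sym_links by (meson symD)
    then have "subdominant_ultrametric X d (x l) (x j) \<le> \<delta>"
      using less.prems finite_X assms(1) by (subst subdominant_ultrametric_le_iff) auto
    then have "merge j \<le> \<delta>" using merge_le[of l j] less.prems by simp
    then have dead: "\<not> alive \<delta> j" using less.prems by (simp add: alive_def)
    have j: "j \<in> {2..n}" using less.prems by simp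
    define k where "k = parent j"
    have k: "1 \<le> k" "k < j" using parent[of j] j by (auto simp: k_def)
    \<comment> \<open>\<open>i\<close> is alive and \<open>j\<close> is dead, so they differ and
      every descent from \<open>j\<close> to \<open>i\<close> passes through the parent of
      \<open>j\<close>.\<close>
    have jk: "(j, i) \<in> descends \<longleftrightarrow> (k, i) \<in> descends"
      using descends_iff[of j i] j dead assms(2) by (auto simp: k_def)
    have "(x k, x j) \<in> (links X d \<delta>)\<^sup>*"
      unfolding k_def by (rule links_parent[OF j assms(1) dead])
    from rtrancl_trans[OF this less.prems(4)] have kl: "(x k, x l) \<in> (links X d \<delta>)\<^sup>*" .
    then have lk: "(x l, x k) \<in> (links X d \<delta>)\<^sup>*" using sym_links by (meson symD)
    consider "k = l" | "l < k" | "k < l" by linarith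
    then show ?case
    proof cases
      case 2
      then show ?thesis using less.hyps[of k l] k j less.prems kl jk by simp
    next
      case 3
      then show ?thesis using less.hyps[of l k] k j less.prems lk jk by simp
    qed (simp add: jk)
  qed
  from this[of j l] this[of l j] assms(3-5) sym_links[THEN symD, OF assms(5)] show ?thesis
    by (cases j l rule: linorder_cases) auto
qed

end

section \<open>The coordinates of a class\<close>

context field
begin

definition vertex :: "'c \<Rightarrow> 'c list \<Rightarrow> 'a" where
  "vertex v = (\<lambda>xs. if xs = [v] then \<one> else \<zero>)"

definition weight :: "'c set \<Rightarrow> ('c list \<Rightarrow> 'a) \<Rightarrow> 'a" where
  "weight S c = (\<Oplus>v\<in>S. c [v])"

lemma simplicial_chains_0I:
  assumes "\<And>xs. c xs \<in> carrier R" "finite {xs. c xs \<noteq> \<zero>}"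
    and "\<And>xs. c xs \<noteq> \<zero> \<Longrightarrow> \<exists>v. xs = [v] \<and> {v} \<in> K"
  shows "c \<in> carrier (simplicial_chains R K 0)"
proof (rule simplicial_chainsI)
  show "length xs = Suc 0 \<and> distinct xs \<and> set xs \<in> K" if "c xs \<noteq> \<zero>" for xs
    using assms(3)[OF that] by auto
  show "c (permute_list \<pi> xs) = (if evenperm \<pi> then c xs else \<ominus> c xs)"
    if "\<pi> permutes {..<length xs}" for \<pi> xs
  proof (cases "length xs \<le> Suc 0")
    case True
    with that have "\<pi> = id" by (rule permutes_length_le_1)
    then show ?thesis by (simp add: evenperm_id)
  next
    case False
    have "c ys = \<zero>" if "length ys = length xs" for ys
      using assms(3)[of ys] False that by force
    then show ?thesis by simp
  qed
qed (use assms in auto)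

lemma chain_0_support:
  assumes "c \<in> carrier (simplicial_chains R K 0)" "c xs \<noteq> \<zero>"
  shows "\<exists>v. xs = [v] \<and> {v} \<in> K"
  using simplicial_chainsD(2)[OF assms] by (auto simp: length_Suc_conv)

lemma weight_closed: "(\<And>v. c [v] \<in> carrier R) \<Longrightarrow> weight S c \<in> carrier R"
  unfolding weight_def by (intro finsum_closed) auto

lemma weight_add:
  assumes "\<And>v. c [v] \<in> carrier R" "\<And>v. c' [v] \<in> carrier R"
  shows "weight S (\<lambda>xs. c xs \<oplus> c' xs) = weight S c \<oplus> weight S c'"
  unfolding weight_def by (rule finsum_addf) (use assms in auto)

lemma weight_smult:
  assumes "\<And>v. c [v] \<in> carrier R" "a \<in> carrier R" "finite S"
  shows "weight S (\<lambda>xs. a \<otimes> c xs) = a \<otimes> weight S c"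
  unfolding weight_def by (rule finsum_rdistr[symmetric]) (use assms in auto)

lemma weight_vertex:
  assumes "finite S"
  shows "weight S (vertex v) = (if v \<in> S then \<one> else \<zero>)"
proof (cases "v \<in> S")
  case True
  have "weight S (vertex v) = (\<Oplus>w\<in>{v}. vertex v [w])"
    unfolding weight_def
    by (rule add.finprod_mono_neutral_cong_right) (use assms True in \<open>auto simp: vertex_def\<close>)
  with True show ?thesis by (simp add: vertex_def)
next
  case False
  then have "weight S (vertex v) = (\<Oplus>w\<in>S. \<zero>)"
    unfolding weight_def by (intro finsum_cong') (auto simp: vertex_def)
  with False show ?thesis by simp
qed

text \<open>
  In characteristic two antisymmetry alone would only give a sum equal to its own negative, hence
  the condition on the diagonal.
\<close>

lemma antisymmetric_finsum:
  assumes "finite S" and f: "\<And>y z. f y z \<in> carrier R"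
    and diag: "\<And>y. f y y = \<zero>" and anti: "\<And>y z. f z y = \<ominus> f y z"
  shows "(\<Oplus>z\<in>S. \<Oplus>y\<in>S. f y z) = \<zero>"
  using assms(1)
proof (induction S rule: finite_induct)
  case (insert a S)
  have row: "(\<Oplus>y\<in>insert a S. f y z) = f a z \<oplus> (\<Oplus>y\<in>S. f y z)" for z
    using insert.hyps f by (intro finsum_insert) auto
  \<comment> \<open>A new index adds a row and a column: the corner is on the diagonal and vanishes,
    and the rest of the row cancels the rest of the column.\<close>
  have "(\<Oplus>z\<in>insert a S. \<Oplus>y\<in>insert a S. f y z)
      = (\<Oplus>y\<in>insert a S. f y a) \<oplus> (\<Oplus>z\<in>S. \<Oplus>y\<in>insert a S. f y z)"
    using insert.hyps f by (intro finsum_insert) (auto intro: finsum_closed)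
  also have "(\<Oplus>y\<in>insert a S. f y a) = (\<Oplus>y\<in>S. f y a)"
    unfolding row using f by (simp add: diag Pi_def finsum_closed)
  also have "(\<Oplus>z\<in>S. \<Oplus>y\<in>insert a S. f y z) = (\<Oplus>z\<in>S. f a z) \<oplus> (\<Oplus>z\<in>S. \<Oplus>y\<in>S. f y z)"
    unfolding row by (rule finsum_addf) (use f in \<open>auto intro: finsum_closed\<close>)
  also have "\<dots> = (\<Oplus>z\<in>S. f a z)"
    using f by (simp add: insert.IH Pi_def finsum_closed)
  also have "(\<Oplus>y\<in>S. f y a) \<oplus> (\<Oplus>z\<in>S. f a z) = (\<Oplus>y\<in>S. f y a \<oplus> f a y)"
    by (rule finsum_addf[symmetric]) (use f in auto)
  also have "\<dots> = (\<Oplus>y\<in>S. \<zero>)"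
    by (rule finsum_cong') (use f in \<open>auto simp: anti[of a] r_neg\<close>)
  finally show ?case by simp
qed simp

text \<open>These are the hypotheses of \<open>antisymmetric_finsum\<close>: the diagonal vanishes
  since simplices have distinct vertices, and the sign is that of a transposition.\<close>

lemma chain_1_antisymmetric:
  assumes c: "c \<in> carrier (simplicial_chains R K (Suc 0))"
  shows "c [y, y] = \<zero>" and "c [z, y] = \<ominus> c [y, z]"
proof -
  show "c [y, y] = \<zero>" using simplicial_chainsD(2)[OF c, of "[y, y]"] by auto
  have "Transposition.transpose 0 (Suc 0) permutes {..<length [y, z]}"
    by (rule permutes_swap_id) auto
  from simplicial_chainsD(4)[OF c this] show "c [z, y] = \<ominus> c [y, z]"
    by (simp add: permute_list_def evenperm_swap Transposition.transpose_def)
qed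

text \<open>No edge in the support of \<open>c\<close> leaves \<open>S\<close>, so the boundary at a
  point of \<open>S\<close> involves only neighbours in \<open>S\<close>. The total is an
  antisymmetric double sum over \<open>S\<close>: the two ends of each edge cancel.\<close>

lemma weight_boundary:
  assumes c: "c \<in> carrier (simplicial_chains R K (Suc 0))" and S: "finite S"
    and closed: "\<And>y z. c [y, z] \<noteq> \<zero> \<Longrightarrow> y \<in> S \<longleftrightarrow> z \<in> S"
  shows "weight S (simplicial_boundary R c) = \<zero>"
proof -
  note D = simplicial_chainsD(1)[OF c]
  have "simplicial_boundary R c [z] = (\<Oplus>y\<in>S. c [y, z])" if "z \<in> S" for z
    by (rule simplicial_boundary_eq[OF c S]) (use closed that in auto)
  then have "weight S (simplicial_boundary R c) = (\<Oplus>z\<in>S. \<Oplus>y\<in>S. c [y, z])"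
    unfolding weight_def using D by (intro finsum_cong') (auto intro: finsum_closed)
  also have "\<dots> = \<zero>"
    by (rule antisymmetric_finsum[OF S D chain_1_antisymmetric[OF c]])
  finally show ?thesis .
qed

section \<open>Boundaries of edges and of paths\<close>

lemma permutes_two:
  assumes "\<pi> permutes {..<2::nat}"
  shows "\<pi> = id \<or> \<pi> = Transposition.transpose 0 1"
proof -
  have "{..<2::nat} = {0, 1}" by auto
  with assms show ?thesis by (simp add: permutes_doubleton_iff)
qed

lemma edge_boundary:
  assumes K: "simplicial_complex K" and yz: "{y, z} \<in> K" "y \<noteq> z"
  shows "(\<lambda>xs. vertex z xs \<ominus> vertex y xs) \<in> simplicial_boundaries R K 0"
proof -
  \<comment> \<open>The elementary chain on the oriented edge from \<open>y\<close> to
    \<open>z\<close>; its value on the reversed list is forced by antisymmetry. The boundary reads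
    off the coefficient at a vertex by prepending the other one, which gives \<open>z\<close> the
    positive sign.\<close>
  define c where "c = (\<lambda>xs. if xs = [y, z] then \<one> else if xs = [z, y] then \<ominus> \<one> else \<zero>)"
  have c: "c \<in> carrier (simplicial_chains R K (Suc 0))"
  proof (rule simplicial_chainsI)
    show "finite {xs. c xs \<noteq> \<zero>}"
      by (rule finite_subset[of _ "{[y, z], [z, y]}"]) (auto simp: c_def)
    show "length xs = Suc (Suc 0) \<and> distinct xs \<and> set xs \<in> K" if "c xs \<noteq> \<zero>" for xs
      using that yz by (auto simp: c_def insert_commute split: if_splits)
    show "c (permute_list \<pi> xs) = (if evenperm \<pi> then c xs else \<ominus> c xs)"
      if \<pi>: "\<pi> permutes {..<length xs}" for \<pi> xs
    proof (cases "length xs = 2")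
      case False
      have "c ys = \<zero>" if "length ys = length xs" for ys
        using False that by (auto simp: c_def)
      then show ?thesis by simp
    next
      case True
      then obtain a b where xs: "xs = [a, b]" by (auto simp: length_Suc_conv numeral_2_eq_2)
      from \<pi> True have "\<pi> = id \<or> \<pi> = Transposition.transpose 0 1" by (intro permutes_two) simp
      then show ?thesis
      proof
        assume "\<pi> = id" then show ?thesis by (simp add: evenperm_id)
      next
        assume "\<pi> = Transposition.transpose 0 1"
        then have "permute_list \<pi> xs = [b, a]" "\<not> evenperm \<pi>"
          by (simp_all add: xs permute_list_def evenperm_swap Transposition.transpose_def)
        then show ?thesis using yz(2) by (auto simp: xs c_def)
      qed
    qed
  qed (auto simp: c_def)
  have "simplicial_boundary R c xs = vertex z xs \<ominus> vertex y xs" for xs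
  proof -
    have "simplicial_boundary R c xs = (\<Oplus>v\<in>{y, z}. c (v # xs))"
      by (rule simplicial_boundary_eq[OF c]) (auto simp: c_def split: if_splits)
    also have "\<dots> = c (y # xs) \<oplus> c (z # xs)"
      using yz(2) simplicial_chainsD(1)[OF c] by (simp add: finsum_insert)
    also have "\<dots> = vertex z xs \<ominus> vertex y xs"
      using yz(2) by (auto simp: c_def vertex_def a_minus_def)
    finally show ?thesis .
  qed
  then have "(\<lambda>xs. vertex z xs \<ominus> vertex y xs) = simplicial_boundary R c" by auto
  then show ?thesis unfolding simplicial_boundaries_def using c by simp
qed

lemma simplicial_boundaries_closed:
  assumes "simplicial_complex K"
  shows "simplicial_boundaries R K 0 \<subseteq> carrier (simplicial_chains R K 0)"
    and "(\<lambda>xs. \<zero>) \<in> simplicial_boundaries R K 0"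
    and "c \<in> simplicial_boundaries R K 0 \<Longrightarrow> c' \<in> simplicial_boundaries R K 0 \<Longrightarrow>
      (\<lambda>xs. c xs \<oplus> c' xs) \<in> simplicial_boundaries R K 0"
    and "a \<in> carrier R \<Longrightarrow> c \<in> simplicial_boundaries R K 0 \<Longrightarrow>
      (\<lambda>xs. a \<otimes> c xs) \<in> simplicial_boundaries R K 0"
  using submodule_simplicial_boundaries[OF assms subset_refl]
  by (simp_all add: submodule_def simplicial_chains_simps)

text \<open>Edge boundaries telescope along a path of links.\<close>

lemma linked_boundary:
  assumes "\<And>y z. y \<in> X \<Longrightarrow> z \<in> X \<Longrightarrow> d y z = d z y" "\<And>y. y \<in> X \<Longrightarrow> d y y = 0"
    and "0 \<le> \<delta>" "(y, z) \<in> (links X d \<delta>)\<^sup>*"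
  shows "(\<lambda>xs. vertex z xs \<ominus> vertex y xs) \<in> simplicial_boundaries R (VR_complex X d \<delta>) 0"
  using assms(4)
proof (induction rule: rtrancl_induct)
  case base
  have "(\<lambda>xs. vertex y xs \<ominus> vertex y xs) = (\<lambda>xs. \<zero>)"
    by (auto simp: vertex_def a_minus_def r_neg)
  then show ?case using simplicial_boundaries_closed(2)[OF simplicial_complex_VR] by simp
next
  case (step z w)
  show ?case
  \<comment> \<open>\<open>links\<close> contains the diagonal, and a loop is not an edge; it
    contributes nothing to the sum.\<close>
  proof (cases "z = w")
    case False
    have "{z, w} \<in> VR_complex X d \<delta>"
      using step.hyps(2) assms(1-3) by (auto simp: links_def VR_complex_def)
    from edge_boundary[OF simplicial_complex_VR this False]
    have "(\<lambda>xs. (vertex z xs \<ominus> vertex y xs) \<oplus> (vertex w xs \<ominus> vertex z xs))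
        \<in> simplicial_boundaries R (VR_complex X d \<delta>) 0"
      by (rule simplicial_boundaries_closed(3)[OF simplicial_complex_VR step.IH])
    moreover have "(vertex z xs \<ominus> vertex y xs) \<oplus> (vertex w xs \<ominus> vertex z xs)
        = vertex w xs \<ominus> vertex y xs" for xs
      by (auto simp: vertex_def a_minus_def r_neg l_neg)
    ultimately show ?thesis by simp
  qed (use step.IH in simp)
qed

end

section \<open>The interval decomposition\<close>

locale enumerated_metric_space_field = field F + enumerated_metric_space X d n x
  for F :: "('f, 'm) ring_scheme" (structure) and X :: "'a set" and d n x
begin

abbreviation VR :: "real \<Rightarrow> 'a set set" where
  "VR \<equiv> VR_complex X d"

text \<open>The root has no parent, and \<open>parent\<close> is an unspecified value there, hence
  the guard.\<close>

definition birth :: "nat \<Rightarrow> 'a list \<Rightarrow> 'f" where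
  "birth m = (\<lambda>xs. vertex (x m) xs \<ominus> (if 2 \<le> m then vertex (x (parent m)) xs else \<zero>))"

text \<open>Dead coordinates are set to zero because the interval has only the zero space there,
  while the weight of a chain on the subtree may well be nonzero.\<close>

definition coordinates :: "real \<Rightarrow> ('a list \<Rightarrow> 'f) \<Rightarrow> 'f \<times> (nat \<Rightarrow> 'f)" where
  "coordinates \<delta> c = (weight (descendants 1) c,
    \<lambda>i\<in>{2..n}. if \<delta> < merge i then weight (descendants i) c else \<zero>)"

definition bars :: "('f, 'f \<times> (nat \<Rightarrow> 'f)) persistence_family" where
  "bars = persistence_sum (interval_persistence F 0 \<infinity>)
    (persistence_sum_family {2..n} (\<lambda>i. interval_persistence F 0 (ereal (merge i))))"

section \<open>Birth chains and subtree weights as dual families\<close>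

lemma singleton_VR: "0 \<le> \<delta> \<Longrightarrow> v \<in> X \<Longrightarrow> {v} \<in> VR \<delta>"
  by (simp add: VR_complex_def)

lemma vertex_closed: "vertex v xs \<in> carrier F"
  by (simp add: vertex_def)

lemma birth_closed: "birth m xs \<in> carrier F"
  by (simp add: birth_def vertex_closed)

lemma birth_in_chains:
  assumes "0 \<le> \<delta>" "m \<in> {1..n}"
  shows "birth m \<in> carrier (simplicial_chains F (VR \<delta>) 0)"
proof (rule simplicial_chains_0I)
  show "\<exists>v. xs = [v] \<and> {v} \<in> VR \<delta>" if "birth m xs \<noteq> \<zero>" for xs
  proof -
    have "xs = [x m] \<or> 2 \<le> m \<and> xs = [x (parent m)]"
      using that by (auto simp: birth_def vertex_def a_minus_def split: if_splits)
    then show ?thesis using assms parent(1,2)[of m] by (auto intro!: singleton_VR)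
  qed
  show "finite {xs. birth m xs \<noteq> \<zero>}"
    by (rule finite_subset[of _ "{[x m], [x (parent m)]}"])
      (auto simp: birth_def vertex_def a_minus_def split: if_splits)
qed (rule birth_closed)

text \<open>A vertex and its parent belong to the same subtrees, except that the subtree rooted at
  the vertex does not contain the parent. The two contributions therefore cancel unless
  \<open>i = m\<close>.\<close>

lemma weight_birth:
  assumes "m \<in> {1..n}"
  shows "weight (descendants i) (birth m) = (if i = m then \<one> else \<zero>)"
proof (cases "2 \<le> m")
  case True
  let ?D = "descendants i"
  have p: "parent m \<in> {1..n}" using parent(1,2)[OF True] assms by simp
  have nd: "(parent m, m) \<notin> descends" using descends_le parent(2)[OF True] by fastforce
  have "birth m = (\<lambda>xs. vertex (x m) xs \<oplus> (\<ominus> \<one>) \<otimes> vertex (x (parent m)) xs)"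
    using True by (auto simp: birth_def vertex_def a_minus_def l_minus)
  then have "weight ?D (birth m)
      = weight ?D (vertex (x m)) \<oplus> weight ?D (\<lambda>xs. (\<ominus> \<one>) \<otimes> vertex (x (parent m)) xs)"
    by (simp add: weight_add vertex_closed)
  also have "weight ?D (\<lambda>xs. (\<ominus> \<one>) \<otimes> vertex (x (parent m)) xs)
      = (\<ominus> \<one>) \<otimes> weight ?D (vertex (x (parent m)))"
    by (rule weight_smult) (auto simp: vertex_closed finite_descendants)
  finally have "weight ?D (birth m) = (if (m, i) \<in> descends then \<one> else \<zero>)
      \<oplus> (\<ominus> \<one>) \<otimes> (if (parent m, i) \<in> descends then \<one> else \<zero>)"
    by (simp add: weight_vertex finite_descendants in_descendants_iff[OF assms] in_descendants_iff[OF p])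
  then show ?thesis
    using descends_iff[OF assms, of i] nd True by (auto simp: r_neg)
next
  case False
  then have m: "m = 1" using assms by simp
  have "birth m = vertex (x m)" using False by (auto simp: birth_def vertex_def a_minus_def)
  then show ?thesis
    using descends_iff[OF assms, of i] False
    by (simp add: weight_vertex finite_descendants in_descendants_iff[OF assms])
qed

lemma birth_boundary:
  assumes "0 \<le> \<delta>" "m \<in> {1..n}" "\<not> alive \<delta> m"
  shows "birth m \<in> simplicial_boundaries F (VR \<delta>) 0"
proof -
  have m: "m \<in> {2..n}" using assms(2,3) by (auto simp: alive_def not_less_eq_eq)
  have "(\<lambda>xs. vertex (x m) xs \<ominus> vertex (x (parent m)) xs) \<in> simplicial_boundaries F (VR \<delta>) 0"
    by (rule linked_boundary[OF commute _ assms(1) links_parent[OF m assms(1,3)]]) simp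
  with m show ?thesis by (simp add: birth_def)
qed

text \<open>Endpoints of an edge are linked, so by \<open>descends_links\<close> the subtree of a
  living index contains both or neither. This is the closure condition of
  \<open>weight_boundary\<close>.\<close>

lemma weight_boundary_alive:
  assumes "0 \<le> \<delta>" "alive \<delta> i" "c \<in> simplicial_boundaries F (VR \<delta>) 0"
  shows "weight (descendants i) c = \<zero>"
proof -
  obtain b where b: "b \<in> carrier (simplicial_chains F (VR \<delta>) (Suc 0))" "c = simplicial_boundary F b"
    using assms(3) by (auto simp: simplicial_boundaries_def)
  have "y \<in> descendants i \<longleftrightarrow> z \<in> descendants i" if "b [y, z] \<noteq> \<zero>" for y z
  proof -
    have yz: "{y, z} \<in> VR \<delta>" using simplicial_chainsD(2)[OF b(1) that] by simp
    then obtain j l where jl: "j \<in> {1..n}" "l \<in> {1..n}" "y = x j" "z = x l"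
      using bij by (auto simp: VR_complex_def bij_betw_def)
    have "(y, z) \<in> links X d \<delta>" using yz by (simp add: VR_complex_def links_def)
    with descends_links[OF assms(1,2) jl(1,2)] show ?thesis
      unfolding jl(3,4) in_descendants_iff[OF jl(1)] in_descendants_iff[OF jl(2)] by blast
  qed
  with weight_boundary[OF b(1) finite_descendants] b(2) show ?thesis by simp
qed

text \<open>
  The chains \<open>birth m\<close> are triangular with respect to the enumeration, so the last vertex of a chain
  can be cleared by a multiple of the corresponding \<open>birth m\<close>.
\<close>

lemma weights_zero_imp_boundary:
  assumes "0 \<le> \<delta>" "c \<in> carrier (simplicial_chains F (VR \<delta>) 0)"
    and "\<And>i. i \<in> {1..n} \<Longrightarrow> alive \<delta> i \<Longrightarrow> weight (descendants i) c = \<zero>"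
  shows "c \<in> simplicial_boundaries F (VR \<delta>) 0"
proof -
  \<comment> \<open>Generalised to chains supported on the first \<open>m\<close> vertices, so that
    an induction can remove one vertex at a time.\<close>
  have "c \<in> simplicial_boundaries F (VR \<delta>) 0"
    if "m \<le> n" "c \<in> carrier (simplicial_chains F (VR \<delta>) 0)"
      "\<And>j. j \<in> {1..n} \<Longrightarrow> m < j \<Longrightarrow> c [x j] = \<zero>"
      "\<And>i. i \<in> {1..n} \<Longrightarrow> alive \<delta> i \<Longrightarrow> weight (descendants i) c = \<zero>" for m c
    using that
  proof (induction m arbitrary: c)
    case 0
    have "c xs = \<zero>" for xs
    proof (rule ccontr)
      assume nz: "c xs \<noteq> \<zero>"
      then obtain v where v: "xs = [v]" "v \<in> X"
        using chain_0_support[OF 0(2)] by (auto simp: VR_complex_def)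
      then obtain j where "j \<in> {1..n}" "v = x j" using bij by (auto simp: bij_betw_def)
      with 0(3)[of j] v nz show False by simp
    qed
    then have "c = (\<lambda>xs. \<zero>)" by auto
    then show ?case using simplicial_boundaries_closed(2)[OF simplicial_complex_VR] by simp
  next
    case (Suc m)
    let ?m = "Suc m" and ?e = "birth (Suc m)"
    have m: "?m \<in> {1..n}" using Suc.prems(1) by simp
    note D = simplicial_chainsD(1)[OF Suc.prems(2)]
    define a where "a = c [x ?m]"
    have a: "a \<in> carrier F" by (simp add: a_def D)
    \<comment> \<open>All other descendants have a larger index, where \<open>c\<close> already
      vanishes; the weight is just the leading coefficient.\<close>
    have we: "weight (descendants ?m) c = a"
    proof -
      have "weight (descendants ?m) c = (\<Oplus>v\<in>{x ?m}. c [v])"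
        unfolding weight_def
      proof (rule add.finprod_mono_neutral_cong_right)
        show "{x ?m} \<subseteq> descendants ?m"
          using in_descendants_iff[OF m] descends_iff[OF m] by simp
        show "c [v] = \<zero>" if v: "v \<in> descendants ?m - {x ?m}" for v
        proof -
          obtain j where j: "j \<in> {1..n}" "v = x j" "(j, ?m) \<in> descends"
            using v by (auto simp: descendants_def)
          with v descends_le[OF j(3)] show ?thesis
            by (intro Suc.prems(3)[of j, folded j(2)]) (auto simp: le_less)
        qed
      qed (use D finite_descendants in auto)
      then show ?thesis using D by (simp add: a_def)
    qed
    define c' where "c' = (\<lambda>xs. c xs \<oplus> (\<ominus> a) \<otimes> ?e xs)"
    have e: "?e \<in> carrier (simplicial_chains F (VR \<delta>) 0)"
      by (rule birth_in_chains[OF assms(1) m])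
    have ae: "(\<lambda>xs. (\<ominus> a) \<otimes> ?e xs) \<in> carrier (simplicial_chains F (VR \<delta>) 0)"
      by (rule simplicial_chains_closed(2)[OF e]) (simp add: a)
    have c': "c' \<in> carrier (simplicial_chains F (VR \<delta>) 0)"
      unfolding c'_def by (rule simplicial_chains_closed(1)[OF Suc.prems(2) ae])
    \<comment> \<open>The subtracted multiple is a boundary either way: if the index is alive,
      \<open>a\<close> is a vanishing weight, and if it is dead, the birth chain bounds.\<close>
    have aeB: "(\<lambda>xs. a \<otimes> ?e xs) \<in> simplicial_boundaries F (VR \<delta>) 0"
    proof (cases "alive \<delta> ?m")
      case True
      then have "a = \<zero>" using Suc.prems(4)[OF m] we by simp
      then show ?thesis
        using simplicial_boundaries_closed(2)[OF simplicial_complex_VR] by (simp add: birth_closed)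
    next
      case False
      from birth_boundary[OF assms(1) m this] show ?thesis
        by (rule simplicial_boundaries_closed(4)[OF simplicial_complex_VR a])
    qed
    have "c' \<in> simplicial_boundaries F (VR \<delta>) 0"
    proof (rule Suc.IH[OF _ c'])
      show "m \<le> n" using Suc.prems(1) by simp
      show "c' [x j] = \<zero>" if j: "j \<in> {1..n}" "m < j" for j
      proof -
        have "parent ?m < j" if "2 \<le> ?m" using parent(2)[OF that] j by simp
        then have "vertex (x (parent ?m)) [x j] = \<zero>" if "2 \<le> ?m"
          using that x_eq_iff[OF j(1), of "parent ?m"] parent(1,2)[OF that] j m by (auto simp: vertex_def)
        then have e: "?e [x j] = vertex (x ?m) [x j]"
          by (auto simp: birth_def vertex_closed a_minus_def)
        show ?thesis
        proof (cases "j = ?m")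
          case True
          then show ?thesis using a D unfolding c'_def e by (simp add: vertex_def a_def r_neg)
        next
          case False
          then show ?thesis using a j m Suc.prems(3)[of j] unfolding c'_def e by (simp add: vertex_def)
        qed
      qed
      show "weight (descendants i) c' = \<zero>" if i: "i \<in> {1..n}" "alive \<delta> i" for i
      proof -
        have "weight (descendants i) c' = weight (descendants i) c \<oplus> (\<ominus> a) \<otimes> weight (descendants i) ?e"
          unfolding c'_def using a D birth_closed finite_descendants
          by (simp add: weight_add weight_smult)
        also have "\<dots> = (\<ominus> a) \<otimes> (if i = ?m then \<one> else \<zero>)"
          using a by (simp add: Suc.prems(4)[OF i] weight_birth[OF m])
        \<comment> \<open>If \<open>i = Suc m\<close>, this index is alive, so its weight
          \<open>a\<close> is zero.\<close>
        also have "\<dots> = \<zero>"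
          using a we Suc.prems(4)[OF i] by auto
        finally show ?thesis .
      qed
    qed
    from simplicial_boundaries_closed(3)[OF simplicial_complex_VR this aeB]
    have "(\<lambda>xs. c' xs \<oplus> a \<otimes> ?e xs) \<in> simplicial_boundaries F (VR \<delta>) 0" .
    moreover have "c' xs \<oplus> a \<otimes> ?e xs = c xs" for xs
      using a D[of xs] birth_closed[of ?m xs] by (simp add: c'_def a_assoc l_minus l_neg)
    ultimately show ?case by simp
  qed
  from this[OF order_refl assms(2) _ assms(3)] show ?thesis by simp
qed

text \<open>By duality the witness is the combination of the birth chains with coefficients
  \<open>f i\<close>. This provides surjectivity of the coordinates.\<close>

lemma chain_with_weights:
  assumes "0 \<le> \<delta>" "\<And>i. f i \<in> carrier F"
  shows "\<exists>c\<in>carrier (simplicial_chains F (VR \<delta>) 0). \<forall>i\<in>{1..n}. weight (descendants i) c = f i"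
proof -
  have "\<exists>c\<in>carrier (simplicial_chains F (VR \<delta>) 0).
      \<forall>i\<in>{1..n}. weight (descendants i) c = (if i \<le> m then f i else \<zero>)" if "m \<le> n" for m
    using that
  proof (induction m)
    case 0
    have "(\<lambda>xs. \<zero>) \<in> carrier (simplicial_chains F (VR \<delta>) 0)"
      by (rule simplicial_chains_0I) auto
    then show ?case by (intro bexI[of _ "\<lambda>xs. \<zero>"]) (auto simp: weight_def)
  next
    case (Suc m)
    then obtain c where c: "c \<in> carrier (simplicial_chains F (VR \<delta>) 0)"
      "\<And>i. i \<in> {1..n} \<Longrightarrow> weight (descendants i) c = (if i \<le> m then f i else \<zero>)"
      by auto
    have m: "Suc m \<in> {1..n}" using Suc.prems by simp
    let ?c = "\<lambda>xs. c xs \<oplus> f (Suc m) \<otimes> birth (Suc m) xs"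
    have "?c \<in> carrier (simplicial_chains F (VR \<delta>) 0)"
      by (intro simplicial_chains_closed c(1) birth_in_chains assms m)
    moreover have "weight (descendants i) ?c = (if i \<le> Suc m then f i else \<zero>)" if "i \<in> {1..n}" for i
      using assms(2) simplicial_chainsD(1)[OF c(1)] birth_closed finite_descendants
      by (auto simp: weight_add weight_smult c(2)[OF that] weight_birth[OF m] le_Suc_eq)
    ultimately show ?case by blast
  qed
  from this[OF order_refl] show ?thesis by auto
qed

section \<open>The coordinate map onto the sum of intervals\<close>

lemma bars_simps:
  assumes "0 \<le> \<delta>"
  shows "carrier (pspace bars \<delta>)
      = carrier F \<times> (\<Pi>\<^sub>E i\<in>{2..n}. if \<delta> < merge i then carrier F else {\<zero>})"
    and "\<zero>\<^bsub>pspace bars \<delta>\<^esub> = (\<zero>, \<lambda>i\<in>{2..n}. \<zero>)"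
    and "v \<oplus>\<^bsub>pspace bars \<delta>\<^esub> w = (fst v \<oplus> fst w, \<lambda>i\<in>{2..n}. snd v i \<oplus> snd w i)"
    and "a \<odot>\<^bsub>pspace bars \<delta>\<^esub> v = (a \<otimes> fst v, \<lambda>i\<in>{2..n}. a \<otimes> snd v i)"
  using assms
  by (simp_all add: bars_def persistence_sum_def persistence_sum_family_def direct_sum_def
      direct_sum_family_simps interval_persistence_def Let_def cong: PiE_cong)

text \<open>A bar alive at the later scale is alive at the earlier one, so a test at \<delta>'
  suffices, and the infinite bar passes unchanged.\<close>

lemma pmap_bars:
  assumes "0 \<le> \<delta>" "\<delta> \<le> \<delta>'"
  shows "pmap bars \<delta> \<delta>' v = (fst v, \<lambda>i\<in>{2..n}. if \<delta>' < merge i then snd v i else \<zero>)"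
  using assms
  by (cases v) (auto simp: bars_def persistence_sum_def persistence_sum_family_def
      interval_persistence_def Let_def intro!: restrict_ext)

lemma persistence_vector_space_bars: "persistence_vector_space F bars"
  unfolding bars_def
  by (intro persistence_vector_space_sum persistence_vector_space_sum_family
      persistence_vector_space_interval field_axioms) simp

lemma linear_map_coordinates:
  assumes "0 \<le> \<delta>"
  shows "linear_map F (simplicial_chains F (VR \<delta>) 0) (pspace bars \<delta>) (coordinates \<delta>)"
proof (rule linear_mapI[OF vectorspace_simplicial_chains
      persistence_vector_space.vectorspace[OF persistence_vector_space_bars assms]], goal_cases)
  case (1 v)
  then show ?case
    using assms simplicial_chainsD(1)[OF 1] by (auto simp: bars_simps coordinates_def weight_closed)
next
  case (2 v w)
  then show ?case
    using assms simplicial_chainsD(1)[OF 2(1)] simplicial_chainsD(1)[OF 2(2)]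
    by (auto simp: bars_simps coordinates_def simplicial_chains_simps weight_add intro!: restrict_ext)
next
  case (3 a v)
  then show ?case
    using assms simplicial_chainsD(1)[OF 3(2)]
    by (auto simp: bars_simps coordinates_def simplicial_chains_simps weight_smult finite_descendants
        intro!: restrict_ext)
qed

text \<open>This presents homology as the quotient by a kernel, ready for
  \<open>kernel_quotient_map\<close>.\<close>

lemma kernel_coordinates:
  assumes "0 \<le> \<delta>"
  shows "simplicial_boundaries F (VR \<delta>) 0
    = {c \<in> carrier (simplicial_chains F (VR \<delta>) 0). coordinates \<delta> c = \<zero>\<^bsub>pspace bars \<delta>\<^esub>}"
proof (intro equalityI subsetI CollectI conjI, goal_cases)
  case (1 c)
  then show ?case using simplicial_boundaries_closed(1)[OF simplicial_complex_VR] by blast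
next
  case (2 c)
  have "weight (descendants i) c = \<zero>" if "alive \<delta> i" for i
    by (rule weight_boundary_alive[OF assms that 2])
  then show ?case
    using assms by (auto simp: coordinates_def bars_simps alive_def intro!: restrict_ext)
next
  case (3 c)
  then have c: "c \<in> carrier (simplicial_chains F (VR \<delta>) 0)"
    and 1: "weight (descendants 1) c = \<zero>"
    and eq: "(\<lambda>i\<in>{2..n}. if \<delta> < merge i then weight (descendants i) c else \<zero>) = (\<lambda>i\<in>{2..n}. \<zero>)"
    using assms by (simp_all add: coordinates_def bars_simps)
  show ?case
  proof (rule weights_zero_imp_boundary[OF assms c])
    fix i assume i: "i \<in> {1..n}" "alive \<delta> i"
    show "weight (descendants i) c = \<zero>"
    proof (cases "i = 1")
      case False
      with fun_cong[OF eq, of i] i show ?thesis by (simp add: alive_def)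
    qed (use 1 in simp)
  qed
qed

lemma coordinates_surj:
  assumes "0 \<le> \<delta>"
  shows "coordinates \<delta> ` carrier (simplicial_chains F (VR \<delta>) 0) = carrier (pspace bars \<delta>)"
proof (intro equalityI subsetI)
  fix w assume "w \<in> coordinates \<delta> ` carrier (simplicial_chains F (VR \<delta>) 0)"
  then show "w \<in> carrier (pspace bars \<delta>)"
    using linear_mapD(3)[OF linear_map_coordinates[OF assms]] by blast
next
  fix w assume w: "w \<in> carrier (pspace bars \<delta>)"
  obtain a g where ag: "w = (a, g)" by (cases w)
  have a: "a \<in> carrier F" and g: "g \<in> (\<Pi>\<^sub>E i\<in>{2..n}. if \<delta> < merge i then carrier F else {\<zero>})"
    using w assms by (simp_all add: ag bars_simps)
  have gi: "g i \<in> (if \<delta> < merge i then carrier F else {\<zero>})" if "i \<in> {2..n}" for i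
    using g that by (rule PiE_mem)
  have gF: "g i \<in> carrier F" if "i \<in> {2..n}" for i
    using gi[OF that] by (cases "\<delta> < merge i") simp_all
  \<comment> \<open>The two summands are joined into one family, with the infinite bar at index 1;
    the default zero keeps \<open>f\<close> in the field where \<open>g\<close> is
    undefined.\<close>
  define f where "f = (\<lambda>i. if i = 1 then a else if i \<in> {2..n} then g i else \<zero>)"
  have "\<And>i. f i \<in> carrier F"
    using a gF by (simp add: f_def)
  from chain_with_weights[of \<delta> f, OF assms this] obtain c
    where c: "c \<in> carrier (simplicial_chains F (VR \<delta>) 0)"
      and wt: "\<And>i. i \<in> {1..n} \<Longrightarrow> weight (descendants i) c = f i" by blast
  have "(\<lambda>i\<in>{2..n}. if \<delta> < merge i then weight (descendants i) c else \<zero>) = restrict g {2..n}"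
  proof (rule restrict_ext)
    fix i assume i: "i \<in> {2..n}"
    then have "weight (descendants i) c = g i" using wt[of i] by (simp add: f_def)
    then show "(if \<delta> < merge i then weight (descendants i) c else \<zero>) = g i"
      using gi[OF i] by (auto split: if_splits)
  qed
  moreover have "weight (descendants 1) c = a" using wt[of 1] n by (simp add: f_def)
  ultimately have "coordinates \<delta> c = w"
    using g by (simp add: coordinates_def ag PiE_restrict)
  with c show "w \<in> coordinates \<delta> ` carrier (simplicial_chains F (VR \<delta>) 0)" by blast
qed

theorem persistence_isomorphic_bars:
  "persistence_isomorphic F (VR_persistent_homology F 0 X d) bars"
proof -
  let ?H = "VR_persistent_homology F 0 X d"
  let ?B = "\<lambda>\<delta>. simplicial_boundaries F (VR \<delta>) 0" and ?C = "\<lambda>\<delta>. simplicial_chains F (VR \<delta>) 0"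
  define \<alpha> where "\<alpha> = (\<lambda>\<delta> A. the_elem (coordinates \<delta> ` A))"
  note Q = subspace_quotient_chains[OF simplicial_complex_VR[of X d]]
  have H: "pspace ?H \<delta> = quotient_module (?C \<delta>) (?B \<delta>)" for \<delta>
    by (simp add: VR_persistent_homology_def simplicial_homology_0)
  have pm: "pmap ?H \<delta> \<delta>' (?B \<delta> +>\<^bsub>?C \<delta>\<^esub> c) = ?B \<delta>' +>\<^bsub>?C \<delta>'\<^esub> c"
    if "\<delta> \<le> \<delta>'" "c \<in> carrier (?C \<delta>)" for \<delta> \<delta>' c
    using inclusion_homology_map_rcoset[OF simplicial_complex_VR simplicial_complex_VR
        VR_complex_mono[OF that(1)] that(2)]
    by (simp add: VR_persistent_homology_def)
  have "persistence_isomorphism F ?H bars \<alpha>"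
    unfolding persistence_isomorphism_def
  proof (intro conjI allI impI ballI)
    show "linear_map F (pspace ?H \<delta>) (pspace bars \<delta>) (\<alpha> \<delta>)"
      "bij_betw (\<alpha> \<delta>) (carrier (pspace ?H \<delta>)) (carrier (pspace bars \<delta>))" if "0 \<le> \<delta>" for \<delta>
      unfolding H \<alpha>_def
      using subspace_quotient.kernel_quotient_map(2,3)[OF Q linear_map_coordinates[OF that]
          kernel_coordinates[OF that] coordinates_surj[OF that]] .
  next
    fix \<delta> \<delta>' :: real and v
    assume \<delta>: "0 \<le> \<delta>" "\<delta> \<le> \<delta>'" and "v \<in> carrier (pspace ?H \<delta>)"
    then obtain c where c: "c \<in> carrier (?C \<delta>)" "v = ?B \<delta> +>\<^bsub>?C \<delta>\<^esub> c"
      unfolding H by (auto simp: subspace_quotient.carrier_quotient[OF Q])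
    have \<alpha>: "\<alpha> \<epsilon> (?B \<epsilon> +>\<^bsub>?C \<epsilon>\<^esub> b) = coordinates \<epsilon> b" if "0 \<le> \<epsilon>" "b \<in> carrier (?C \<epsilon>)" for \<epsilon> b
      unfolding \<alpha>_def
      by (rule subspace_quotient.kernel_quotient_map(1)[OF Q linear_map_coordinates[OF that(1)]
          kernel_coordinates[OF that(1)] coordinates_surj[OF that(1)] that(2)])
    have "c \<in> carrier (?C \<delta>')"
      using simplicial_chains_mono[OF VR_complex_mono[OF \<delta>(2)]] c(1) by blast
    then have "\<alpha> \<delta>' (pmap ?H \<delta> \<delta>' v) = coordinates \<delta>' c"
      using \<delta> by (simp add: c pm \<alpha>)
    \<comment> \<open>Naturality: the weights of \<open>c\<close> do not depend on the scale, so
      passing to \<delta>' only sets the newly dead coordinates to zero.\<close>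
    also have "\<dots> = pmap bars \<delta> \<delta>' (coordinates \<delta> c)"
      using \<delta> by (auto simp: pmap_bars coordinates_def intro!: restrict_ext)
    also have "\<dots> = pmap bars \<delta> \<delta>' (\<alpha> \<delta> v)"
      using \<delta>(1) c by (simp add: \<alpha>)
    finally show "\<alpha> \<delta>' (pmap ?H \<delta> \<delta>' v) = pmap bars \<delta> \<delta>' (\<alpha> \<delta> v)" .
  qed
  moreover have "persistence_vector_space F ?H"
    unfolding VR_persistent_homology_def
    by (rule persistence_vector_space_filtration[OF simplicial_complex_VR VR_complex_mono])
  ultimately show ?thesis
    unfolding persistence_isomorphic_def using persistence_vector_space_bars by blast
qed

end

theorem proposition4p19:
  fixes X :: "'a set" and d :: "'a \<Rightarrow> 'a \<Rightarrow> real" and n :: nat and x :: "nat \<Rightarrow> 'a"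
  assumes "Metric_space X d" and "finite X" and "card X = n" and "n \<ge> 1"
    and "bij_betw x {1..n} X"
  shows "persistence_isomorphic (residue_ring 2)
    (VR_persistent_homology (residue_ring 2) 0 X d)
    (persistence_sum (interval_persistence (residue_ring 2) 0 \<infinity>)
      (persistence_sum_family {2..n}
        (\<lambda>i. interval_persistence (residue_ring 2) 0
          (ereal (Min ((\<lambda>k. subdominant_ultrametric X d (x k) (x i)) ` {1..<i}))))))"
proof -
  have "field (residue_ring 2)"
    using residues_prime.is_field[of 2] by (simp add: residues_prime_def)
  then have loc: "enumerated_metric_space_field (residue_ring 2) X d n x"
    using assms by (intro enumerated_metric_space_field.intro enumerated_metric_space.intro
        enumerated_metric_space_axioms.intro)
  have sp: "enumerated_metric_space X d n x"
    using loc by (rule enumerated_metric_space_field.axioms(2))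
  show ?thesis
    using enumerated_metric_space_field.persistence_isomorphic_bars[OF loc]
    unfolding enumerated_metric_space_field.bars_def[OF loc] enumerated_metric_space.merge_def[OF sp] .
qed

end
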